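(* Let $P$ be the pseudo-arc. The conjugation action of $H(P)$ on $I(P)$, given by $(g,h)\mapsto ghg^{-1}$ for $g\in H(P)$ and $h\in I(P)$, has a dense orbit (that is, some orbit is dense in $I(P)$).
   Context: A continuum is a compact connected metric space. It is indecomposable if it is not a union of two proper subcontinua, and hereditarily indecomposable if every subcontinuum is indecomposable. A continuum is chainable if each open cover of it is refined by an open cover $U_1,\dots,U_n$ such that for all $i,j$, $U_i\cap U_j\ne\emptyset$ iff $|j-i|\le 1$. The pseudo-arc $P$ is the unique (nondegenerate) hereditarily indecomposable chainable continuum. $H(P)$ is the homeomorphism group of $P$ with the compact-open topology, and $I(P)=\{h\in H(P)\colon h^2=\mathrm{id}\}$ is the set of involutions of $P$ with the subspace topology. *)

theory Defs
  imports "HOL-Analysis.Analysis" "HOL-Algebra.Group_Action"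
begin

text \<open>Continua are nonempty, compact, connected subsets of an ambient metric space, carrying the
  induced metric.\<close>

definition continuum :: "'a::metric_space set \<Rightarrow> bool" where
  "continuum X \<longleftrightarrow> X \<noteq> {} \<and> compact X \<and> connected X"

definition indecomposable :: "'a::metric_space set \<Rightarrow> bool" where
  "indecomposable X \<longleftrightarrow>
     \<not> (\<exists>A B. continuum A \<and> continuum B \<and> A \<subset> X \<and> B \<subset> X \<and> X = A \<union> B)"

definition hereditarily_indecomposable :: "'a::metric_space set \<Rightarrow> bool" where
  "hereditarily_indecomposable X \<longleftrightarrow> (\<forall>Y. Y \<subseteq> X \<and> continuum Y \<longrightarrow> indecomposable Y)"

definition open_cover_of :: "'a::metric_space set \<Rightarrow> 'a set set \<Rightarrow> bool" where
  "open_cover_of X \<C> \<longleftrightarrow> (\<forall>C\<in>\<C>. openin (top_of_set X) C) \<and> \<Union>\<C> = X"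

definition chainable :: "'a::metric_space set \<Rightarrow> bool" where
  "chainable X \<longleftrightarrow>
     (\<forall>\<C>. open_cover_of X \<C> \<longrightarrow>
       (\<exists>n (U :: nat \<Rightarrow> 'a set).
          open_cover_of X (U ` {1..n}) \<and>
          (\<forall>i\<in>{1..n}. \<exists>C\<in>\<C>. U i \<subseteq> C) \<and>
          (\<forall>i\<in>{1..n}. \<forall>j\<in>{1..n}. U i \<inter> U j \<noteq> {} \<longleftrightarrow> \<bar>int j - int i\<bar> \<le> 1)))"

text \<open>This determines \<open>P\<close> up to homeomorphism (Bing); it is a predicate because the pseudo-arc is a
  homeomorphism type rather than a particular set. Nondegenerate means having at least two points.\<close>

definition pseudo_arc :: "'a::metric_space set \<Rightarrow> bool" where
  "pseudo_arc P \<longleftrightarrow> continuum P \<and> (\<exists>x\<in>P. \<exists>y\<in>P. x \<noteq> y) \<and>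
     hereditarily_indecomposable P \<and> chainable P"

text \<open>Maps on a space are represented by extensional functions, as in \<^const>\<open>Bij\<close>, so that
  two maps that agree on the space are equal.\<close>

definition compact_open_topology :: "'a topology \<Rightarrow> 'b topology \<Rightarrow> ('a \<Rightarrow> 'b) topology" where
  "compact_open_topology X Y = topology_generated_by
     {{f \<in> extensional (topspace X). continuous_map X Y f \<and> f ` K \<subseteq> U} | K U.
        compactin X K \<and> openin Y U}"

lemma topspace_compact_open_topology:
  "topspace (compact_open_topology X Y) = {f \<in> extensional (topspace X). continuous_map X Y f}"
proof -
  have "{f \<in> extensional (topspace X). continuous_map X Y f} \<in>
     {{f \<in> extensional (topspace X). continuous_map X Y f \<and> f ` K \<subseteq> U} | K U.
        compactin X K \<and> openin Y U}"
    by (rule CollectI, rule exI[of _ "{}"], rule exI[of _ "{}"]) auto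
  then show ?thesis
    unfolding compact_open_topology_def topology_generated_by_topspace by blast
qed

definition homeo_group :: "'a::metric_space set \<Rightarrow> ('a \<Rightarrow> 'a) monoid" where
  "homeo_group P =
     BijGroup P \<lparr>carrier := {h \<in> Bij P. homeomorphic_map (top_of_set P) (top_of_set P) h}\<rparr>"

lemma subgroup_homeo_group:
  "subgroup {h \<in> Bij P. homeomorphic_map (top_of_set P) (top_of_set P) h} (BijGroup P)"
proof (rule subgroup.intro)
  show "{h \<in> Bij P. homeomorphic_map (top_of_set P) (top_of_set P) h} \<subseteq> carrier (BijGroup P)"
    by (auto simp: BijGroup_def)
next
  fix x y
  assume x: "x \<in> {h \<in> Bij P. homeomorphic_map (top_of_set P) (top_of_set P) h}"
    and y: "y \<in> {h \<in> Bij P. homeomorphic_map (top_of_set P) (top_of_set P) h}"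
  have "homeomorphic_map (top_of_set P) (top_of_set P) (x \<circ> y)"
    using x y by (auto intro: homeomorphic_map_compose)
  then have "homeomorphic_map (top_of_set P) (top_of_set P) (compose P x y)"
    by (rule homeomorphic_map_eq) (simp add: compose_def)
  then show "x \<otimes>\<^bsub>BijGroup P\<^esub> y \<in> {h \<in> Bij P. homeomorphic_map (top_of_set P) (top_of_set P) h}"
    using x y by (auto simp: BijGroup_def compose_Bij)
next
  have "homeomorphic_map (top_of_set P) (top_of_set P) (\<lambda>x\<in>P. x)"
    by (rule homeomorphic_map_eq[of _ _ id]) auto
  then show "\<one>\<^bsub>BijGroup P\<^esub> \<in> {h \<in> Bij P. homeomorphic_map (top_of_set P) (top_of_set P) h}"
    by (auto simp: BijGroup_def id_Bij)
next
  fix x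
  assume x: "x \<in> {h \<in> Bij P. homeomorphic_map (top_of_set P) (top_of_set P) h}"
  then obtain g where g: "homeomorphic_maps (top_of_set P) (top_of_set P) x g"
    using homeomorphic_map_maps by blast
  then have "homeomorphic_map (top_of_set P) (top_of_set P) g"
    using homeomorphic_maps_map by blast
  moreover have "g y = restrict (inv_into P x) P y" if "y \<in> P" for y
  proof -
    have "g y \<in> P" "x (g y) = y"
      using g that by (auto simp: homeomorphic_maps_def continuous_map_def)
    then have "inv_into P x (x (g y)) = g y"
      using x by (intro inv_into_f_f) (auto simp: Bij_def bij_betw_def)
    then show ?thesis
      using \<open>x (g y) = y\<close> that by simp
  qed
  ultimately have "homeomorphic_map (top_of_set P) (top_of_set P) (restrict (inv_into P x) P)"
    by (rule homeomorphic_map_eq) auto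
  then show "inv\<^bsub>BijGroup P\<^esub> x \<in> {h \<in> Bij P. homeomorphic_map (top_of_set P) (top_of_set P) h}"
    using x by (auto simp: inv_BijGroup restrict_inv_into_Bij)
qed

lemma group_homeo_group: "group (homeo_group P)"
  unfolding homeo_group_def
  by (rule subgroup.subgroup_is_group[OF subgroup_homeo_group group_BijGroup])

definition involutions :: "'a::metric_space set \<Rightarrow> ('a \<Rightarrow> 'a) set" where
  "involutions P =
     {h \<in> carrier (homeo_group P). h \<otimes>\<^bsub>homeo_group P\<^esub> h = \<one>\<^bsub>homeo_group P\<^esub>}"

definition involution_topology :: "'a::metric_space set \<Rightarrow> ('a \<Rightarrow> 'a) topology" where
  "involution_topology P =
     subtopology (compact_open_topology (top_of_set P) (top_of_set P)) (involutions P)"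

lemma topspace_involution_topology: "topspace (involution_topology P) = involutions P"
proof -
  have "involutions P \<subseteq> topspace (compact_open_topology (top_of_set P) (top_of_set P))"
    using homeomorphic_imp_continuous_map[of "top_of_set P" "top_of_set P"]
    unfolding topspace_compact_open_topology by (auto simp: involutions_def homeo_group_def Bij_def
        simp del: continuous_map_subtopology_eu)
  then show ?thesis
    by (auto simp: involution_topology_def)
qed

definition conjugation_action :: "'a::metric_space set \<Rightarrow> ('a \<Rightarrow> 'a) \<Rightarrow> ('a \<Rightarrow> 'a) \<Rightarrow> ('a \<Rightarrow> 'a)" where
  "conjugation_action P =
     (\<lambda>g. \<lambda>h \<in> involutions P. g \<otimes>\<^bsub>homeo_group P\<^esub> h \<otimes>\<^bsub>homeo_group P\<^esub> inv\<^bsub>homeo_group P\<^esub> g)"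

lemma group_action_conjugation:
  "group_action (homeo_group P) (involutions P) (conjugation_action P)"
proof -
  let ?G = "homeo_group P"
  interpret G: group ?G by (rule group_homeo_group)
  have cl: "g \<otimes>\<^bsub>?G\<^esub> h \<otimes>\<^bsub>?G\<^esub> inv\<^bsub>?G\<^esub> g \<in> involutions P"
    if g: "g \<in> carrier ?G" and h: "h \<in> involutions P" for g h
  proof -
    have hc: "h \<in> carrier ?G" and hh: "h \<otimes>\<^bsub>?G\<^esub> h = \<one>\<^bsub>?G\<^esub>"
      using h by (auto simp: involutions_def)
    have "(g \<otimes>\<^bsub>?G\<^esub> h \<otimes>\<^bsub>?G\<^esub> inv\<^bsub>?G\<^esub> g) \<otimes>\<^bsub>?G\<^esub> (g \<otimes>\<^bsub>?G\<^esub> h \<otimes>\<^bsub>?G\<^esub> inv\<^bsub>?G\<^esub> g)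
        = g \<otimes>\<^bsub>?G\<^esub> h \<otimes>\<^bsub>?G\<^esub> (inv\<^bsub>?G\<^esub> g \<otimes>\<^bsub>?G\<^esub> g) \<otimes>\<^bsub>?G\<^esub> h \<otimes>\<^bsub>?G\<^esub> inv\<^bsub>?G\<^esub> g"
      using g hc by (simp only: G.m_assoc G.m_closed G.inv_closed)
    also have "\<dots> = g \<otimes>\<^bsub>?G\<^esub> (h \<otimes>\<^bsub>?G\<^esub> h) \<otimes>\<^bsub>?G\<^esub> inv\<^bsub>?G\<^esub> g"
      using g hc by (simp add: G.m_assoc)
    also have "\<dots> = \<one>\<^bsub>?G\<^esub>"
      using g by (simp add: hh)
    finally show ?thesis
      using g hc by (simp add: involutions_def)
  qed
  have comp: "(g1 \<otimes>\<^bsub>?G\<^esub> g2) \<otimes>\<^bsub>?G\<^esub> h \<otimes>\<^bsub>?G\<^esub> inv\<^bsub>?G\<^esub> (g1 \<otimes>\<^bsub>?G\<^esub> g2)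
      = g1 \<otimes>\<^bsub>?G\<^esub> (g2 \<otimes>\<^bsub>?G\<^esub> h \<otimes>\<^bsub>?G\<^esub> inv\<^bsub>?G\<^esub> g2) \<otimes>\<^bsub>?G\<^esub> inv\<^bsub>?G\<^esub> g1"
    if "g1 \<in> carrier ?G" "g2 \<in> carrier ?G" "h \<in> involutions P" for g1 g2 h
    using that by (simp add: G.inv_mult_group G.m_assoc involutions_def)
  have one: "\<one>\<^bsub>?G\<^esub> \<otimes>\<^bsub>?G\<^esub> h \<otimes>\<^bsub>?G\<^esub> inv\<^bsub>?G\<^esub> \<one>\<^bsub>?G\<^esub> = h" if "h \<in> involutions P" for h
    using that by (simp add: involutions_def)
  have bij: "conjugation_action P g \<in> Bij (involutions P)" if g: "g \<in> carrier ?G" for g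
  proof -
    have "bij_betw (conjugation_action P g) (involutions P) (involutions P)"
    proof (rule bij_betw_byWitness[where f' = "conjugation_action P (inv\<^bsub>?G\<^esub> g)"])
      show "\<forall>h\<in>involutions P. conjugation_action P (inv\<^bsub>?G\<^esub> g) (conjugation_action P g h) = h"
        using g comp[of "inv\<^bsub>?G\<^esub> g" g, symmetric] one
        by (simp add: conjugation_action_def cl)
      show "\<forall>h\<in>involutions P. conjugation_action P g (conjugation_action P (inv\<^bsub>?G\<^esub> g) h) = h"
        using g comp[of g "inv\<^bsub>?G\<^esub> g", symmetric] one cl[of "inv\<^bsub>?G\<^esub> g"]
        by (simp add: conjugation_action_def)
    qed (use g cl cl[of "inv\<^bsub>?G\<^esub> g"] in \<open>auto simp: conjugation_action_def\<close>)
    then show ?thesis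
      by (simp add: Bij_def conjugation_action_def)
  qed
  have "conjugation_action P (g1 \<otimes>\<^bsub>?G\<^esub> g2) =
      conjugation_action P g1 \<otimes>\<^bsub>BijGroup (involutions P)\<^esub> conjugation_action P g2"
    if "g1 \<in> carrier ?G" "g2 \<in> carrier ?G" for g1 g2
  proof
    fix h
    show "conjugation_action P (g1 \<otimes>\<^bsub>?G\<^esub> g2) h =
      (conjugation_action P g1 \<otimes>\<^bsub>BijGroup (involutions P)\<^esub> conjugation_action P g2) h"
      using that comp[OF that, of h] bij[OF that(1)] bij[OF that(2)] cl[OF that(2), of h]
      by (auto simp: BijGroup_def compose_def conjugation_action_def)
  qed
  then have "conjugation_action P \<in> hom ?G (BijGroup (involutions P))"
    using bij by (auto simp: hom_def BijGroup_def)
  then show ?thesis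
    by (simp add: group_action_def group_hom_def group_hom_axioms_def group_BijGroup
        group_homeo_group)
qed

end

theory Submission
  imports Defs
begin

text \<open>Every nontrivial involution \<open>F\<close> of a pseudo-arc has a dense orbit. On the one hand, up to the mesh of a
  chain every involution \<open>f\<close> is a quotient of the flip of an arc: walk through a fine chain, starting at a link
  which is almost fixed by \<open>f\<close>, and record the image walk in the opposite direction. On the other hand
  \<open>\<phi> - \<phi> \<circ> F\<close> is an odd map onto a symmetric interval as soon as \<open>\<phi> x \<noteq> \<phi> (F x)\<close> for some \<open>x\<close>, so \<open>F\<close> itself has the flip as an
  exact quotient. It remains to lift this to an approximate conjugacy: hereditary indecomposability allows a
  chain to be lifted through any surjective walk, and with chainability a back-and-forth argument yields, for
  any two chains of equal length, a homeomorphism that carries one to the other link by link.\<close>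

subsection \<open>Separation in hereditarily indecomposable continua\<close>

text \<open>The obstacle to lifting is that intersecting links is not enough: where a walk turns
  back, one link must be shared among several passes, and pieces of different passes may touch only
  at the turns. Hereditary indecomposability provides such pieces: by compactness the question
  reduces to two components, one of a set \<open>K\<close> and one of a set \<open>L\<close>, which
  are disjoint or nested. The resulting cover by three closed pieces is the criterion of
  Krasinkiewicz and Minc, and it lifts a single zigzag; any walk from end to end is reduced to the
  identity by removing stutters and zigzags with three equal legs. In the final comparison only the
  length of the flip-invariant chain of \<open>F\<close> matters, not its mesh, since errors are
  measured in a chain chosen for \<open>f\<close>, after the homeomorphism has been applied. Hence
  one fixed nontrivial \<open>F\<close> serves every \<open>f\<close> and every precision. The
  existence of a nontrivial involution is never established: if there is none, the orbit of the
  identity already consists of all involutions.\<close>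

lemma compact_union_induct:
  fixes B :: "'a::topological_space set"
  assumes "compact B" "Q {}" "\<And>S T. Q S \<Longrightarrow> Q T \<Longrightarrow> Q (S \<union> T)"
    and loc: "\<And>y. y \<in> B \<Longrightarrow> \<exists>W. open W \<and> y \<in> W \<and> Q (B \<inter> W)"
  shows "Q B"
proof -
  obtain W where W: "\<And>y. y \<in> B \<Longrightarrow> open (W y) \<and> y \<in> W y \<and> Q (B \<inter> W y)"
    using loc by metis
  obtain D where D: "D \<subseteq> B" "finite D" "B \<subseteq> (\<Union>y\<in>D. W y)"
    by (rule compactE_image[OF assms(1), of B W]) (use W in auto)
  have "Q (B \<inter> (\<Union>y\<in>D'. W y))" if "D' \<subseteq> D" for D'
    using finite_subset[OF that D(2)] that
  proof (induction D' rule: finite_induct)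
    case (insert y D')
    have "B \<inter> (\<Union>y\<in>insert y D'. W y) = (B \<inter> W y) \<union> (B \<inter> (\<Union>y\<in>D'. W y))"
      by auto
    then show ?case
      using insert W D by (auto intro!: assms(3))
  qed (simp add: assms(2))
  from this[of D] show ?thesis
    using D(3) by (simp add: Int_absorb2)
qed

definition clopen_in :: "'a::metric_space set \<Rightarrow> 'a set \<Rightarrow> bool" where
  "clopen_in K E \<longleftrightarrow> openin (top_of_set K) E \<and> closedin (top_of_set K) E"

lemma clopen_in_Un: "clopen_in K E \<Longrightarrow> clopen_in K E' \<Longrightarrow> clopen_in K (E \<union> E')"
  and clopen_in_Int: "clopen_in K E \<Longrightarrow> clopen_in K E' \<Longrightarrow> clopen_in K (E \<inter> E')"
  and clopen_in_empty: "clopen_in K {}"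
  and clopen_in_self: "clopen_in K K"
  by (auto simp: clopen_in_def)

text \<open>In a compact Hausdorff space components are quasi-components. The form used is the
  cut-wire-fence theorem: a connected set through \<open>x\<close> stays in the component, hence in
  \<open>W\<close>, so nothing connected joins \<open>x\<close> to \<open>K - W\<close>.\<close>

lemma component_clopen_neighbourhood:
  fixes K :: "'a::metric_space set"
  assumes K: "compact K" and x: "x \<in> K"
    and W: "open W" "connected_component_set K x \<subseteq> W"
  obtains E where "clopen_in K E" "x \<in> E" "E \<subseteq> W"
proof -
  have "separated_between (top_of_set K) {x} (K - W)"
  proof (rule cut_wire_fence_theorem)
    show "compact_space (top_of_set K)"
      using K by (simp add: compact_space_subtopology)
    show "Hausdorff_space (top_of_set K)"
      by (simp add: Hausdorff_space_subtopology)
    show "closedin (top_of_set K) {x}"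
      using x by (simp add: closed_subset)
    show "closedin (top_of_set K) (K - W)"
      using W(1) by (metis Diff_eq closed_Compl closedin_closed_Int)
    show "disjnt C {x} \<or> disjnt C (K - W)" if "connectedin (top_of_set K) C" for C
    proof (cases "x \<in> C")
      case True
      have "connected C" "C \<subseteq> K"
        using that by (auto simp: connectedin_subtopology)
      then have "C \<subseteq> connected_component_set K x"
        using True by (simp add: connected_component_maximal)
      then show ?thesis
        using W(2) by (auto simp: disjnt_def)
    qed (simp add: disjnt_def)
  qed
  then obtain E where "closedin (top_of_set K) E" "openin (top_of_set K) E" "{x} \<subseteq> E" "K - W \<subseteq> K - E"
    unfolding separated_between by auto
  moreover then have "E \<subseteq> W"
    using openin_imp_subset by blast
  ultimately show ?thesis
    using that by (auto simp: clopen_in_def)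
qed

text \<open>Two overlapping continua have a continuum as their union. If neither contained the
  other, both would be proper in it and would decompose it.\<close>

lemma hereditarily_indecomposable_subset_or_disjoint:
  assumes "hereditarily_indecomposable P" "continuum A" "continuum B" "A \<subseteq> P" "B \<subseteq> P" "A \<inter> B \<noteq> {}"
  shows "A \<subseteq> B \<or> B \<subseteq> A"
proof (rule ccontr)
  assume "\<not> ?thesis"
  moreover have "continuum (A \<union> B)"
    using assms by (auto simp: continuum_def intro: connected_Un)
  moreover then have "indecomposable (A \<union> B)"
    using assms by (auto simp: hereditarily_indecomposable_def)
  ultimately show False
    using assms unfolding indecomposable_def by (metis Un_upper1 Un_upper2 psubsetI sup.orderI subset_Un_eq Un_commute)
qed

text \<open>For single points \<open>x\<close> and \<open>y\<close> the relevant components are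
  disjoint continua, which clopen sets can separate. Compactness of \<open>B\<close> and then of
  \<open>A\<close> passes from points to sets.\<close>

lemma hereditarily_indecomposable_separation:
  fixes P :: "'a::metric_space set"
  assumes P: "compact P" "hereditarily_indecomposable P"
    and KL: "compact K" "compact L" "K \<subseteq> P" "L \<subseteq> P"
    and AB: "compact A" "compact B" "A \<subseteq> K" "B \<subseteq> L" "A \<inter> L = {}" "B \<inter> K = {}"
  shows "\<exists>E F. clopen_in K E \<and> clopen_in L F \<and> A \<subseteq> E \<and> B \<subseteq> F \<and> E \<inter> F = {}"
proof -
  define sep where "sep S T \<longleftrightarrow> (\<exists>E F. clopen_in K E \<and> clopen_in L F \<and> S \<subseteq> E \<and> T \<subseteq> F \<and> E \<inter> F = {})"
    for S T
  \<comment> \<open>Enlarging one side means a union of clopen sets there and an intersection on the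
    other side, so disjointness survives.\<close>
  have sepL: "sep (S \<union> S') T" if "sep S T" "sep S' T" for S S' T
  proof -
    obtain E F E' F' where *: "clopen_in K E" "clopen_in L F" "S \<subseteq> E" "T \<subseteq> F" "E \<inter> F = {}"
      "clopen_in K E'" "clopen_in L F'" "S' \<subseteq> E'" "T \<subseteq> F'" "E' \<inter> F' = {}"
      using \<open>sep S T\<close> \<open>sep S' T\<close> unfolding sep_def by metis
    then show ?thesis
      unfolding sep_def
      by (intro exI[of _ "E \<union> E'"] exI[of _ "F \<inter> F'"]) (auto simp: clopen_in_Un clopen_in_Int)
  qed
  have sepR: "sep S (T \<union> T')" if "sep S T" "sep S T'" for S T T'
  proof -
    obtain E F E' F' where *: "clopen_in K E" "clopen_in L F" "S \<subseteq> E" "T \<subseteq> F" "E \<inter> F = {}"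
      "clopen_in K E'" "clopen_in L F'" "S \<subseteq> E'" "T' \<subseteq> F'" "E' \<inter> F' = {}"
      using \<open>sep S T\<close> \<open>sep S T'\<close> unfolding sep_def by metis
    then show ?thesis
      unfolding sep_def
      by (intro exI[of _ "E \<inter> E'"] exI[of _ "F \<union> F'"]) (auto simp: clopen_in_Un clopen_in_Int)
  qed
  have points: "\<exists>E F. clopen_in K E \<and> clopen_in L F \<and> x \<in> E \<and> y \<in> F \<and> E \<inter> F = {}"
    if "x \<in> A" "y \<in> B" for x y
  proof -
    let ?Cx = "connected_component_set K x" and ?Cy = "connected_component_set L y"
    have mem: "x \<in> ?Cx" "y \<in> ?Cy"
      using that AB by (auto intro: connected_component_refl)
    have sub: "?Cx \<subseteq> K" "?Cy \<subseteq> L"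
      by (auto simp: connected_component_subset)
    have cpt: "compact ?Cx" "compact ?Cy"
      using KL closedin_compact closedin_connected_component by blast+
    \<comment> \<open>The only use of hereditary indecomposability: if the components met, they
      would be nested, which puts \<open>x\<close> into \<open>L\<close> or \<open>y\<close> into
      \<open>K\<close>, against the assumptions on \<open>A\<close> and \<open>B\<close>.\<close>
    have "?Cx \<inter> ?Cy = {}"
    proof (rule ccontr)
      assume "?Cx \<inter> ?Cy \<noteq> {}"
      moreover have "continuum ?Cx" "continuum ?Cy"
        using mem cpt unfolding continuum_def by (blast intro: connected_connected_component)+
      ultimately have "?Cx \<subseteq> ?Cy \<or> ?Cy \<subseteq> ?Cx"
        using hereditarily_indecomposable_subset_or_disjoint[OF P(2)] sub KL by (meson order_trans)
      then show False
        using mem sub that AB by blast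
    qed
    then obtain W W' where W: "open W" "open W'" "?Cx \<subseteq> W" "?Cy \<subseteq> W'" "W \<inter> W' = {}"
      using compact_imp_closed[OF cpt(1)] compact_imp_closed[OF cpt(2)] by (metis t4_space)
    have xy: "x \<in> K" "y \<in> L"
      using that AB by auto
    obtain E where "clopen_in K E" "x \<in> E" "E \<subseteq> W"
      by (rule component_clopen_neighbourhood[OF KL(1) xy(1) W(1,3)])
    moreover obtain F where "clopen_in L F" "y \<in> F" "F \<subseteq> W'"
      by (rule component_clopen_neighbourhood[OF KL(2) xy(2) W(2,4)])
    ultimately show ?thesis
      using W(5) by blast
  qed
  have point_set: "\<exists>W. open W \<and> x \<in> W \<and> sep (A \<inter> W) B" if x: "x \<in> A" for x
  proof -
    have "sep {x} B"
    proof (rule compact_union_induct[OF AB(2)])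
      show "sep {x} {}"
        unfolding sep_def using clopen_in_self clopen_in_empty x AB by blast
      show "\<exists>W. open W \<and> y \<in> W \<and> sep {x} (B \<inter> W)" if y: "y \<in> B" for y
      proof -
        obtain E F where EF: "clopen_in K E" "clopen_in L F" "x \<in> E" "y \<in> F" "E \<inter> F = {}"
          using points[OF x y] by blast
        then obtain W where W: "open W" "F = L \<inter> W"
          by (auto simp: clopen_in_def openin_open)
        then have "{x} \<subseteq> E" "B \<inter> W \<subseteq> F" "y \<in> W"
          using EF AB by auto
        then show ?thesis
          using EF W unfolding sep_def by blast
      qed
    qed (use sepR in auto)
    then obtain E F where EF: "clopen_in K E" "clopen_in L F" "x \<in> E" "B \<subseteq> F" "E \<inter> F = {}"
      by (auto simp: sep_def)
    then obtain W where W: "open W" "E = K \<inter> W"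
      by (auto simp: clopen_in_def openin_open)
    then have "A \<inter> W \<subseteq> E" "x \<in> W"
      using EF AB by auto
    then show ?thesis
      using EF W unfolding sep_def by blast
  qed
  have "sep A B"
  proof (rule compact_union_induct[OF AB(1)])
    show "sep {} B"
      unfolding sep_def using clopen_in_self clopen_in_empty AB by blast
  qed (use sepL point_set in auto)
  then show ?thesis
    by (simp add: sep_def)
qed

section \<open>From clopen separation to a cover by three closed pieces\<close>

lemma separate_compact_dist:
  fixes S T :: "'a::metric_space set"
  assumes "compact S" "compact T" "S \<inter> T = {}"
  shows "\<exists>d>0. \<forall>x\<in>S. \<forall>y\<in>T. d \<le> dist x y"
proof (cases "S = {} \<or> T = {}")
  case False
  then obtain z where z: "z \<in> S" "\<And>x. x \<in> S \<Longrightarrow> infdist z T \<le> infdist x T"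
    using continuous_attains_inf[OF assms(1), of "\<lambda>x. infdist x T"]
      continuous_on_infdist[OF continuous_on_id, of S T] by auto
  have "infdist z T > 0"
    using infdist_pos_not_in_closed[OF compact_imp_closed[OF assms(2)]] False z(1) assms(3) by blast
  then show ?thesis
    using z infdist_le order_trans by metis
qed (auto intro: exI[of _ 1])

lemma clopen_in_compact:
  assumes "compact K" "clopen_in K E"
  shows "compact E" "compact (K - E)" "E \<subseteq> K"
proof -
  have "closedin (top_of_set K) (K - E)"
    using assms(2) by (auto simp: clopen_in_def)
  then show "compact (K - E)"
    using assms(1) closedin_compact by blast
  show "compact E"
    using assms closedin_compact clopen_in_def by blast
  show "E \<subseteq> K"
    using assms(2) openin_imp_subset by (auto simp: clopen_in_def)
qed

lemma infdist_less_witness: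
  assumes "E \<noteq> {}" "infdist x E < r"
  obtains e where "e \<in> E" "dist x e < r"
proof -
  have "\<exists>e\<in>E. dist x e < r"
  proof (rule ccontr)
    assume "\<not> ?thesis"
    then have "r \<le> infdist x E"
      unfolding infdist_notempty[OF assms(1)] by (intro cINF_greatest[OF assms(1)]) auto
    then show False
      using assms(2) by simp
  qed
  then show ?thesis
    using that by blast
qed

text \<open>This is the Krasinkiewicz-Minc criterion with a Lebesgue number. \<open>X1\<close> and
  \<open>X3\<close> are closed thickenings in \<open>P\<close> of the clopen sets \<open>E\<close>
  and \<open>F\<close>, and \<open>X2\<close> consists of the points away from both. A point of
  \<open>X1 \<inter> X2\<close> is near \<open>E\<close> but outside it, and \<open>K\<close> has no
  such points because \<open>K - E\<close> is at positive distance from \<open>E\<close>; likewise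
  for \<open>F\<close> and \<open>L\<close>.\<close>

lemma three_piece_cover:
  fixes P :: "'a::metric_space set"
  assumes P: "compact P" "hereditarily_indecomposable P"
    and KL: "compact K" "compact L" "K \<subseteq> P" "L \<subseteq> P"
    and AB: "compact A" "compact B" "A \<subseteq> K" "B \<subseteq> L" "A \<inter> L = {}" "B \<inter> K = {}"
    and ne: "A \<noteq> {}" "B \<noteq> {}"
  obtains X1 X2 X3 \<delta> where
    "closed X1" "closed X2" "closed X3" "A \<subseteq> X1" "B \<subseteq> X3"
    "X1 \<inter> X3 = {}" "X1 \<inter> X2 \<inter> K = {}" "X2 \<inter> X3 \<inter> L = {}"
    "\<delta> > 0" "\<forall>x\<in>P. P \<inter> ball x \<delta> \<subseteq> X1 \<or> P \<inter> ball x \<delta> \<subseteq> X2 \<or> P \<inter> ball x \<delta> \<subseteq> X3"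
proof -
  obtain E F where EF: "clopen_in K E" "clopen_in L F" "A \<subseteq> E" "B \<subseteq> F" "E \<inter> F = {}"
    using hereditarily_indecomposable_separation[OF P KL AB] by blast
  note cE = clopen_in_compact[OF KL(1) EF(1)] and cF = clopen_in_compact[OF KL(2) EF(2)]
  have "\<exists>d>0. \<forall>x\<in>E. \<forall>y\<in>(K - E) \<union> F. d \<le> dist x y"
    by (rule separate_compact_dist) (use cE cF EF(5) in auto)
  then obtain d1 where d1: "d1 > 0" "\<forall>x\<in>E. \<forall>y\<in>(K - E) \<union> F. d1 \<le> dist x y"
    by blast
  have "\<exists>d>0. \<forall>x\<in>F. \<forall>y\<in>L - F. d \<le> dist x y"
    by (rule separate_compact_dist) (use cF in auto)
  then obtain d2 where d2: "d2 > 0" "\<forall>x\<in>F. \<forall>y\<in>L - F. d2 \<le> dist x y"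
    by blast
  \<comment> \<open>The outer pieces have radius \<open>2 * r\<close> and the middle piece begins at
    distance \<open>r\<close>. The overlap is thus a layer of width \<open>r\<close>, and a ball of
    radius \<open>r / 2\<close> about any point stays in one piece, with the cut at
    \<open>3 * r / 2\<close>. Points within \<open>2 * r\<close> of \<open>E\<close> and of
    \<open>F\<close> have witnesses closer than \<open>3 * r\<close>, and twice that is at most
    \<open>d1\<close>.\<close>
  define r where "r = min d1 d2 / 6"
  have r: "r > 0" "6 * r \<le> d1" "6 * r \<le> d2"
    using d1(1) d2(1) by (auto simp: r_def)
  have neE: "E \<noteq> {}" and neF: "F \<noteq> {}"
    using ne EF by auto
  let ?X1 = "{x\<in>P. infdist x E \<le> 2 * r}" and ?X3 = "{x\<in>P. infdist x F \<le> 2 * r}"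
  let ?X2 = "{x\<in>P. r \<le> infdist x E \<and> r \<le> infdist x F}"
  have close: "\<exists>e\<in>E. dist x e < 3 * r" if "infdist x E \<le> 2 * r" for x
    using infdist_less_witness[OF neE, of x "3 * r"] that r by auto
  have close': "\<exists>e\<in>F. dist x e < 3 * r" if "infdist x F \<le> 2 * r" for x
    using infdist_less_witness[OF neF, of x "3 * r"] that r by auto
  show ?thesis
  proof (rule that)
    have "closed P"
      using P(1) by (rule compact_imp_closed)
    moreover have "closed {x. infdist x E \<le> 2 * r}" "closed {x. infdist x F \<le> 2 * r}"
      "closed {x. r \<le> infdist x E}" "closed {x. r \<le> infdist x F}"
      by (intro closed_Collect_le continuous_intros)+
    ultimately show "closed ?X1" "closed ?X2" "closed ?X3"
      by (auto simp: Collect_conj_eq intro!: closed_Int)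
    show "A \<subseteq> ?X1" "B \<subseteq> ?X3"
      using EF AB KL r by auto
    show "?X1 \<inter> ?X3 = {}"
    proof (rule ccontr)
      assume "?X1 \<inter> ?X3 \<noteq> {}"
      then obtain x where "infdist x E \<le> 2 * r" "infdist x F \<le> 2 * r"
        by auto
      then obtain e f where ef: "e \<in> E" "dist x e < 3 * r" "f \<in> F" "dist x f < 3 * r"
        using close close' by meson
      have "dist e f < 6 * r"
        using dist_triangle3[of e f x] ef by simp
      then show False
        using d1(2)[rule_format, of e f] ef r by auto
    qed
    show "?X1 \<inter> ?X2 \<inter> K = {}"
    proof (rule ccontr)
      assume "?X1 \<inter> ?X2 \<inter> K \<noteq> {}"
      then obtain x where x: "x \<in> K" "infdist x E \<le> 2 * r" "r \<le> infdist x E"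
        by auto
      then have "x \<notin> E"
        using r by auto
      moreover obtain e where e: "e \<in> E" "dist x e < 3 * r"
        using close x by meson
      ultimately show False
        using d1(2)[rule_format, of e x] x(1) r by (auto simp: dist_commute)
    qed
    show "?X2 \<inter> ?X3 \<inter> L = {}"
    proof (rule ccontr)
      assume "?X2 \<inter> ?X3 \<inter> L \<noteq> {}"
      then obtain x where x: "x \<in> L" "infdist x F \<le> 2 * r" "r \<le> infdist x F"
        by auto
      then have "x \<notin> F"
        using r by auto
      moreover obtain e where e: "e \<in> F" "dist x e < 3 * r"
        using close' x by meson
      ultimately show False
        using d2(2)[rule_format, of e x] x(1) r by (auto simp: dist_commute)
    qed
    show "r / 2 > 0"
      using r by simp
    show "\<forall>x\<in>P. P \<inter> ball x (r / 2) \<subseteq> ?X1 \<or> P \<inter> ball x (r / 2) \<subseteq> ?X2 \<or> P \<inter> ball x (r / 2) \<subseteq> ?X3"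
    proof
      fix x assume x: "x \<in> P"
      have near: "\<bar>infdist y S - infdist x S\<bar> < r / 2" if "y \<in> P" "dist x y < r / 2" for y S
        using infdist_triangle_abs[of y S x] that(2) by (simp add: dist_commute)
      consider "infdist x E \<le> 3 * r / 2" | "infdist x F \<le> 3 * r / 2"
        | "infdist x E > 3 * r / 2" "infdist x F > 3 * r / 2"
        by linarith
      then show "P \<inter> ball x (r / 2) \<subseteq> ?X1 \<or> P \<inter> ball x (r / 2) \<subseteq> ?X2 \<or> P \<inter> ball x (r / 2) \<subseteq> ?X3"
      proof cases
        case 1
        have "P \<inter> ball x (r / 2) \<subseteq> ?X1"
        proof
          fix y assume "y \<in> P \<inter> ball x (r / 2)"
          then have y: "y \<in> P" "dist x y < r / 2"
            by auto
          show "y \<in> ?X1"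
            using near[OF y, of E] near[OF y, of F] 1 y(1)
            by (intro CollectI conjI) linarith+
        qed
        then show ?thesis ..
      next
        case 2
        have "P \<inter> ball x (r / 2) \<subseteq> ?X3"
        proof
          fix y assume "y \<in> P \<inter> ball x (r / 2)"
          then have y: "y \<in> P" "dist x y < r / 2"
            by auto
          show "y \<in> ?X3"
            using near[OF y, of E] near[OF y, of F] 2 y(1)
            by (intro CollectI conjI) linarith+
        qed
        then show ?thesis by blast
      next
        case 3
        have "P \<inter> ball x (r / 2) \<subseteq> ?X2"
        proof
          fix y assume "y \<in> P \<inter> ball x (r / 2)"
          then have y: "y \<in> P" "dist x y < r / 2"
            by auto
          show "y \<in> ?X2"
            using near[OF y, of E] near[OF y, of F] 3 y(1)
            by (intro CollectI conjI) linarith+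
        qed
        then show ?thesis by blast
      qed
    qed
  qed
qed

subsection \<open>Closed chains\<close>

text \<open>The Lebesgue number makes consecutive links overlap substantially, so that sufficiently small sets lie in a
  single link. The private points of the end links are what prevents a lift from losing its ends.\<close>

definition closed_chain :: "'a::metric_space set \<Rightarrow> nat \<Rightarrow> (nat \<Rightarrow> 'a set) \<Rightarrow> bool" where
  "closed_chain P n V \<longleftrightarrow> 0 < n \<and> (\<forall>i\<le>n. closed (V i) \<and> V i \<subseteq> P) \<and>
     (\<exists>\<delta>>0. \<forall>x\<in>P. \<exists>i\<le>n. P \<inter> ball x \<delta> \<subseteq> V i) \<and>
     (\<forall>i\<le>n. \<forall>j\<le>n. Suc i < j \<longrightarrow> V i \<inter> V j = {}) \<and>
     (\<exists>a\<in>V 0. \<forall>i\<le>n. a \<in> V i \<longrightarrow> i = 0) \<and> (\<exists>b\<in>V n. \<forall>i\<le>n. b \<in> V i \<longrightarrow> i = n)"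

text \<open>The index map that arises when one chain refines another: consecutive links meet, so
  indices move by at most one, and stutters are allowed.\<close>

definition walk :: "nat \<Rightarrow> nat \<Rightarrow> (nat \<Rightarrow> nat) \<Rightarrow> bool" where
  "walk m n s \<longleftrightarrow> (\<forall>k\<le>m. s k \<le> n) \<and> (\<forall>k<m. s (Suc k) \<le> Suc (s k) \<and> s k \<le> Suc (s (Suc k)))"

lemma closed_chain_lebesgue:
  assumes "closed_chain P n V"
  obtains \<delta> where "\<delta> > 0" "\<forall>x\<in>P. \<exists>i\<le>n. P \<inter> ball x \<delta> \<subseteq> V i"
  using assms by (auto simp: closed_chain_def)

lemma closed_chain_ends:
  assumes "closed_chain P n V"
  obtains a b where "a \<in> V 0" "\<forall>i\<le>n. a \<in> V i \<longrightarrow> i = 0" "b \<in> V n" "\<forall>i\<le>n. b \<in> V i \<longrightarrow> i = n"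
  using assms by (auto simp: closed_chain_def)

lemma closed_chain_adjacent:
  assumes "closed_chain P n V" "i \<le> n" "j \<le> n" "x \<in> V i" "x \<in> V j"
  shows "i \<le> Suc j" "j \<le> Suc i"
proof -
  have "\<not> Suc j < i" "\<not> Suc i < j"
    using assms unfolding closed_chain_def by blast+
  then show "i \<le> Suc j" "j \<le> Suc i"
    by auto
qed

lemma closed_chain_cover:
  assumes "closed_chain P n V" "x \<in> P"
  obtains i where "i \<le> n" "x \<in> V i"
proof -
  obtain \<delta> where "\<delta> > 0" "\<forall>x\<in>P. \<exists>i\<le>n. P \<inter> ball x \<delta> \<subseteq> V i"
    by (rule closed_chain_lebesgue[OF assms(1)])
  then obtain i where "i \<le> n" "P \<inter> ball x \<delta> \<subseteq> V i" "\<delta> > 0"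
    using assms(2) by blast
  then show ?thesis
    using that assms(2) by auto
qed

text \<open>For an inner link without a private point, the links before it and the links after it
  would already cover \<open>P\<close> by two disjoint nonempty closed sets. For the end links the
  definition supplies the point.\<close>

lemma closed_chain_private:
  assumes P: "connected P" and V: "closed_chain P n V" and i: "i \<le> n"
  shows "\<exists>x\<in>V i. \<forall>j\<le>n. x \<in> V j \<longrightarrow> j = i"
proof (cases "i = 0 \<or> i = n")
  case True
  then show ?thesis
    using V by (auto simp: closed_chain_def)
next
  case False
  let ?A = "\<Union>j\<in>{..<i}. V j" and ?B = "\<Union>j\<in>{i<..n}. V j"
  have V': "closed (V j)" "V j \<subseteq> P" if "j \<le> n" for j
    using V that by (auto simp: closed_chain_def)
  show ?thesis
  proof (rule ccontr)
    assume np: "\<not> ?thesis"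
    have "P \<subseteq> ?A \<union> ?B"
    proof
      fix x assume "x \<in> P"
      then obtain j where j: "j \<le> n" "x \<in> V j"
        using closed_chain_cover[OF V] by blast
      obtain j' where "j' \<le> n" "x \<in> V j'" "j' \<noteq> i"
        using np j by (cases "j = i") auto
      then show "x \<in> ?A \<union> ?B"
        by (cases "j' < i") auto
    qed
    moreover have "closed ?A" "closed ?B"
      using V' i by (auto intro!: closed_UN)
    moreover have "?A \<inter> ?B \<inter> P = {}"
    proof (rule equals0I)
      fix x assume "x \<in> ?A \<inter> ?B \<inter> P"
      then obtain j l where "j < i" "x \<in> V j" "i < l" "l \<le> n" "x \<in> V l"
        by auto
      then show False
        using closed_chain_adjacent(2)[OF V, of j l x] by auto
    qed
    moreover have "?A \<inter> P \<noteq> {}" "?B \<inter> P \<noteq> {}"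
    proof -
      obtain a b where "a \<in> V 0" "b \<in> V n"
        using V by (auto simp: closed_chain_def)
      then show "?A \<inter> P \<noteq> {}" "?B \<inter> P \<noteq> {}"
        using False i V'(2)[of 0] V'(2)[of n] by (force, force)
    qed
    ultimately show False
      using connected_closedD[OF P, of ?A ?B] by argo
  qed
qed

lemma closed_chain_link_Int:
  assumes P: "connected P" and V: "closed_chain P n V" and i: "i < n"
  shows "V i \<inter> V (Suc i) \<noteq> {}"
proof
  assume empty: "V i \<inter> V (Suc i) = {}"
  let ?A = "\<Union>j\<in>{..i}. V j" and ?B = "\<Union>j\<in>{i<..n}. V j"
  have V': "closed (V j)" "V j \<subseteq> P" if "j \<le> n" for j
    using V that by (auto simp: closed_chain_def)
  have "P \<subseteq> ?A \<union> ?B"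
  proof
    fix x assume "x \<in> P"
    then obtain j where "j \<le> n" "x \<in> V j"
      using closed_chain_cover[OF V] by blast
    then show "x \<in> ?A \<union> ?B"
      by (cases "j \<le> i") auto
  qed
  moreover have "closed ?A" "closed ?B"
    using V' i by (auto intro!: closed_UN)
  moreover have "?A \<inter> ?B \<inter> P = {}"
  proof (rule equals0I)
    fix x assume "x \<in> ?A \<inter> ?B \<inter> P"
    then obtain j l where jl: "j \<le> i" "x \<in> V j" "i < l" "l \<le> n" "x \<in> V l"
      by auto
    then have "j = i" "l = Suc i"
      using closed_chain_adjacent(2)[OF V, of j l x] by auto
    then show False
      using empty jl by blast
  qed
  moreover have "?A \<inter> P \<noteq> {}" "?B \<inter> P \<noteq> {}"
  proof -
    obtain a b where "a \<in> V 0" "b \<in> V n"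
      using V by (auto simp: closed_chain_def)
    then show "?A \<inter> P \<noteq> {}" "?B \<inter> P \<noteq> {}"
      using i V'(2)[of 0] V'(2)[of n] by (force, force)
  qed
  ultimately show False
    using connected_closedD[OF P, of ?A ?B] by argo
qed

text \<open>Link \<open>i\<close> is cut into two overlapping halves, one on the side of the earlier
  links and one on the side of the later links. All other links keep their extent, since
  \<open>X\<close> contains the earlier links and \<open>Y\<close> the later ones.\<close>

lemma closed_chain_stutter:
  assumes P: "compact P" and V: "closed_chain P n V" and i: "i \<le> n"
  shows "\<exists>H. closed_chain P (Suc n) H \<and> (\<forall>k\<le>Suc n. H k \<subseteq> V (if k \<le> i then k else k - 1))"
proof -
  have V': "0 < n" "\<And>j. j \<le> n \<Longrightarrow> closed (V j)" "\<And>j. j \<le> n \<Longrightarrow> V j \<subseteq> P"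
    using V by (auto simp: closed_chain_def)
  obtain a b where a: "a \<in> V 0" "\<forall>i\<le>n. a \<in> V i \<longrightarrow> i = 0"
    and b: "b \<in> V n" "\<forall>i\<le>n. b \<in> V i \<longrightarrow> i = n"
    by (rule closed_chain_ends[OF V])
  have cpt: "compact (V j)" if "j \<le> n" for j
    using P V' that by (metis closed_Int_compact inf.absorb_iff1)
  define A where "A = insert a (\<Union>j\<in>{..<i}. V j)"
  define B where "B = insert b (\<Union>j\<in>{i<..n}. V j)"
  have "compact A" "compact B"
    using cpt i by (auto simp: A_def B_def intro!: compact_insert compact_UN)
  moreover have "A \<inter> B = {}"
  proof (rule equals0I)
    fix x assume x: "x \<in> A \<inter> B"
    have "a \<noteq> b"
      using a(1) b(2)[rule_format, of 0] V'(1) by auto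
    then consider j l where "x \<in> V j" "x \<in> V l" "j < i" "i < l" "l \<le> n"
      | l where "a \<in> V l" "i < l" "l \<le> n" | l where "b \<in> V l" "l < i"
      using x unfolding A_def B_def by auto
    then show False
    proof cases
      case (1 j l)
      then show ?thesis
        using closed_chain_adjacent(2)[OF V, of j l x] by auto
    next
      case (2 l)
      then show ?thesis
        using a(2)[rule_format, of l] by auto
    next
      case (3 l)
      then show ?thesis
        using b(2)[rule_format, of l] i by auto
    qed
  qed
  ultimately have "\<exists>d>0. \<forall>x\<in>A. \<forall>y\<in>B. d \<le> dist x y"
    by (rule separate_compact_dist)
  then obtain d where d: "d > 0" "\<forall>x\<in>A. \<forall>y\<in>B. d \<le> dist x y"
    by blast
  have ne: "A \<noteq> {}" "B \<noteq> {}"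
    by (auto simp: A_def B_def)
  \<comment> \<open>A point of \<open>A\<close> has distance at least \<open>d\<close> from
    \<open>B\<close>, so the slack \<open>d / 2\<close> keeps \<open>A\<close> out of
    \<open>Y\<close> and \<open>B\<close> out of \<open>X\<close>. Within radius
    \<open>d / 4\<close> each of the two distances changes by less than \<open>d / 4\<close>, so the
    slack absorbs the change of their difference.\<close>
  define X where "X = {x. infdist x A \<le> infdist x B + d / 2}"
  define Y where "Y = {x. infdist x B \<le> infdist x A + d / 2}"
  have cl: "closed X" "closed Y"
    unfolding X_def Y_def by (intro closed_Collect_le continuous_intros)+
  have AX: "A \<subseteq> X" "B \<subseteq> Y"
    using d(1) by (auto simp: X_def Y_def intro!: add_nonneg_nonneg infdist_nonneg)
  have AY: "x \<notin> Y" if "x \<in> A" for x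
  proof
    assume "x \<in> Y"
    then have "infdist x B < d"
      using that d(1) by (simp add: Y_def)
    then obtain y where "y \<in> B" "dist x y < d"
      using infdist_less_witness[OF ne(2)] by blast
    then show False
      using d(2) that by (meson not_le)
  qed
  have BX: "x \<notin> X" if "x \<in> B" for x
  proof
    assume "x \<in> X"
    then have "infdist x A < d"
      using that d(1) by (simp add: X_def)
    then obtain y where "y \<in> A" "dist x y < d"
      using infdist_less_witness[OF ne(1)] by blast
    then show False
      using d(2) that by (metis dist_commute not_le)
  qed
  have XY: "ball x (d / 4) \<subseteq> X \<or> ball x (d / 4) \<subseteq> Y" for x
  proof -
    have near: "\<bar>infdist y S - infdist x S\<bar> < d / 4" if "y \<in> ball x (d / 4)" for y S
      using infdist_triangle_abs[of y S x] that by (simp add: dist_commute)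
    show ?thesis
    proof (cases "infdist x A \<le> infdist x B")
      case True
      have "y \<in> X" if "y \<in> ball x (d / 4)" for y
        using near[OF that, of A] near[OF that, of B] True unfolding X_def mem_Collect_eq by linarith
      then show ?thesis
        by blast
    next
      case False
      have "y \<in> Y" if "y \<in> ball x (d / 4)" for y
        using near[OF that, of A] near[OF that, of B] False unfolding Y_def mem_Collect_eq by linarith
      then show ?thesis
        by blast
    qed
  qed
  define z where "z k = (if k \<le> i then k else k - 1)" for k
  define H where "H k = V (z k) \<inter> (if k \<le> i then X else Y)" for k
  have z: "z k \<le> n" if "k \<le> Suc n" for k
    using that i by (auto simp: z_def)
  have below: "x \<notin> Y" if "x \<in> V j" "j < i" for x j
    using that by (intro AY) (auto simp: A_def)
  have above: "x \<notin> X" if "x \<in> V j" "i < j" "j \<le> n" for x j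
    using that by (intro BX) (auto simp: B_def)
  obtain \<delta> where \<delta>: "\<delta> > 0" "\<forall>x\<in>P. \<exists>i\<le>n. P \<inter> ball x \<delta> \<subseteq> V i"
    by (rule closed_chain_lebesgue[OF V])
  have "closed_chain P (Suc n) H"
    unfolding closed_chain_def
  proof (intro conjI allI impI ballI)
    show "closed (H k)" "H k \<subseteq> P" if "k \<le> Suc n" for k
      using V' z[OF that] cl by (auto simp: H_def)
    show "\<exists>\<epsilon>>0. \<forall>x\<in>P. \<exists>k\<le>Suc n. P \<inter> ball x \<epsilon> \<subseteq> H k"
    proof (intro exI[of _ "min \<delta> (d / 4)"] conjI ballI)
      fix x assume x: "x \<in> P"
      then obtain j where j: "j \<le> n" "P \<inter> ball x \<delta> \<subseteq> V j"
        using \<delta> by blast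
      then have xj: "x \<in> V j"
        using x \<delta> by auto
      show "\<exists>k\<le>Suc n. P \<inter> ball x (min \<delta> (d / 4)) \<subseteq> H k"
      proof (cases "ball x (d / 4) \<subseteq> X")
        case True
        then have "x \<in> X"
          using d(1) by auto
        then have "j \<le> i"
          using above xj j by (meson not_le)
        then show ?thesis
          using True j by (intro exI[of _ j]) (auto simp: H_def z_def)
      next
        case False
        then have Y: "ball x (d / 4) \<subseteq> Y"
          using XY by blast
        then have "x \<in> Y"
          using d(1) by auto
        then have "i \<le> j"
          using below xj j by (meson not_le)
        then show ?thesis
          using Y j by (intro exI[of _ "Suc j"]) (auto simp: H_def z_def)
      qed
    qed (use \<delta>(1) d(1) in auto)
    show "H k \<inter> H l = {}" if kl: "k \<le> Suc n" "l \<le> Suc n" "Suc k < l" for k l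
    proof (rule ccontr)
      assume "H k \<inter> H l \<noteq> {}"
      then obtain x where x: "x \<in> H k" "x \<in> H l"
        by blast
      then have "z l \<le> Suc (z k)"
        using closed_chain_adjacent[OF V, of "z k" "z l" x] z kl by (auto simp: H_def)
      then have *: "l = Suc (Suc k)" "k \<le> i" "i < l"
        using kl(3) by (auto simp: z_def split: if_splits)
      show False
      proof (cases "k = i")
        case True
        then show False
          using above[of x "Suc i"] x * kl by (auto simp: H_def z_def)
      next
        case False
        then show False
          using below[of x k] x * kl by (auto simp: H_def z_def)
      qed
    qed
    show "\<exists>a\<in>H 0. \<forall>k\<le>Suc n. a \<in> H k \<longrightarrow> k = 0"
    proof (intro bexI[of _ a] allI impI)
      show "a \<in> H 0"
        using a AX by (auto simp: H_def z_def A_def)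
      fix k assume k: "k \<le> Suc n" "a \<in> H k"
      then have "z k = 0"
        using a(2)[rule_format, of "z k"] z by (auto simp: H_def)
      moreover have "k \<le> i"
        using k AY[of a] by (auto simp: H_def A_def split: if_splits)
      ultimately show "k = 0"
        by (simp add: z_def)
    qed
    show "\<exists>b\<in>H (Suc n). \<forall>k\<le>Suc n. b \<in> H k \<longrightarrow> k = Suc n"
    proof (intro bexI[of _ b] allI impI)
      show "b \<in> H (Suc n)"
        using b AX i by (auto simp: H_def z_def B_def)
      fix k assume k: "k \<le> Suc n" "b \<in> H k"
      then have "z k = n"
        using b(2)[rule_format, of "z k"] z by (auto simp: H_def)
      moreover have "\<not> k \<le> i"
        using k BX[of b] by (auto simp: H_def B_def split: if_splits)
      ultimately show "k = Suc n"
        using k V'(1) by (auto simp: z_def)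
    qed
  qed simp
  moreover have "\<forall>k\<le>Suc n. H k \<subseteq> V (if k \<le> i then k else k - 1)"
    by (simp add: H_def z_def)
  ultimately show ?thesis
    by blast
qed

text \<open>Here hereditary indecomposability enters the lifting. The new index runs up to
  \<open>d\<close>, back to \<open>c\<close> and up again. The three legs live in the three pieces
  of \<open>three_piece_cover\<close>, which meet only where the walk turns.\<close>

lemma closed_chain_zigzag:
  assumes P: "compact P" "hereditarily_indecomposable P" and V: "closed_chain P n V"
    and cd: "c < d" "d \<le> n"
  shows "\<exists>H. closed_chain P (n + 2 * (d - c)) H \<and>
    (\<forall>k\<le>n + 2 * (d - c). H k \<subseteq> V (if k \<le> d then k else if k \<le> d + (d - c) then 2 * d - k else k - 2 * (d - c)))"
proof -
  have V': "0 < n" "\<And>j. j \<le> n \<Longrightarrow> closed (V j)" "\<And>j. j \<le> n \<Longrightarrow> V j \<subseteq> P"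
    using V by (auto simp: closed_chain_def)
  obtain a b where a: "a \<in> V 0" "\<forall>i\<le>n. a \<in> V i \<longrightarrow> i = 0"
    and b: "b \<in> V n" "\<forall>i\<le>n. b \<in> V i \<longrightarrow> i = n"
    by (rule closed_chain_ends[OF V])
  have cpt: "compact (V j)" if "j \<le> n" for j
    using P V' that by (metis closed_Int_compact inf.absorb_iff1)
  define A where "A = insert a (\<Union>j\<in>{..<c}. V j)"
  define B where "B = insert b (\<Union>j\<in>{d<..n}. V j)"
  \<comment> \<open>A point of \<open>X1 \<inter> X2\<close> avoids \<open>K\<close>, so every link
    through it has index at least \<open>d\<close>, the upper turn. A point of
    \<open>X2 \<inter> X3\<close> avoids \<open>L\<close>, so its links have index at most
    \<open>c\<close>, the lower turn.\<close>
  define K where "K = (\<Union>j\<in>{..<d}. V j)"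
  define L where "L = (\<Union>j\<in>{c<..n}. V j)"
  have cKLAB: "compact K" "compact L" "compact A" "compact B"
    using cpt cd by (auto simp: A_def B_def K_def L_def intro!: compact_insert compact_UN)
  have "V j \<subseteq> P" if "j < d" for j
    using V'(3) that cd by simp
  then have KP: "K \<subseteq> P"
    unfolding K_def by blast
  have LP: "L \<subseteq> P"
    unfolding L_def by (intro UN_least V'(3)) simp
  have AK: "A \<subseteq> K"
    using a(1) cd by (force simp: A_def K_def)
  have BL: "B \<subseteq> L"
    using b(1) cd by (force simp: B_def L_def)
  have AL: "A \<inter> L = {}"
  proof (rule equals0I)
    fix x assume "x \<in> A \<inter> L"
    then consider j l where "x \<in> V j" "x \<in> V l" "j < c" "c < l" "l \<le> n"
      | l where "a \<in> V l" "c < l" "l \<le> n"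
      unfolding A_def L_def by auto
    then show False
    proof cases
      case (1 j l)
      then show ?thesis
        using closed_chain_adjacent(2)[OF V, of j l x] by auto
    next
      case (2 l)
      then show ?thesis
        using a(2)[rule_format, of l] by auto
    qed
  qed
  have BK: "B \<inter> K = {}"
  proof (rule equals0I)
    fix x assume "x \<in> B \<inter> K"
    then consider j l where "x \<in> V j" "x \<in> V l" "j < d" "d < l" "l \<le> n"
      | l where "b \<in> V l" "l < d"
      unfolding B_def K_def by auto
    then show False
    proof cases
      case (1 j l)
      then show ?thesis
        using closed_chain_adjacent(2)[OF V, of j l x] by auto
    next
      case (2 l)
      then show ?thesis
        using b(2)[rule_format, of l] cd by auto
    qed
  qed
  have ne: "A \<noteq> {}" "B \<noteq> {}"
    by (auto simp: A_def B_def)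
  obtain X1 X2 X3 \<eta> where X: "closed X1" "closed X2" "closed X3" "A \<subseteq> X1" "B \<subseteq> X3"
    "X1 \<inter> X3 = {}" "X1 \<inter> X2 \<inter> K = {}" "X2 \<inter> X3 \<inter> L = {}" "\<eta> > 0"
    and \<eta>: "\<forall>x\<in>P. P \<inter> ball x \<eta> \<subseteq> X1 \<or> P \<inter> ball x \<eta> \<subseteq> X2 \<or> P \<inter> ball x \<eta> \<subseteq> X3"
    by (rule three_piece_cover[OF P cKLAB(1,2) KP LP cKLAB(3,4) AK BL AL BK ne])
  define e where "e = d + (d - c)"
  define m where "m = n + 2 * (d - c)"
  define z where "z k = (if k \<le> d then k else if k \<le> e then 2 * d - k else k - 2 * (d - c))" for k
  \<comment> \<open>At the turning indices \<open>d\<close> and \<open>e\<close> the pieces of both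
    adjoining legs are united, because the turn belongs to both.\<close>
  define X where "X k = (if k \<le> d then X1 else {}) \<union> (if d \<le> k \<and> k \<le> e then X2 else {}) \<union> (if e \<le> k then X3 else {})"
    for k
  define H where "H k = V (z k) \<inter> X k" for k
  have z: "z k \<le> n" if "k \<le> m" for k
    using that cd by (auto simp: z_def m_def e_def)
  have clX: "closed (X k)" for k
    using X by (auto simp: X_def)
  obtain \<delta> where \<delta>: "\<delta> > 0" "\<forall>x\<in>P. \<exists>i\<le>n. P \<inter> ball x \<delta> \<subseteq> V i"
    by (rule closed_chain_lebesgue[OF V])
  have in1: "x \<in> X1" if "x \<in> V j" "j < c" for x j
  proof -
    have "x \<in> A"
      using that by (auto simp: A_def)
    then show ?thesis
      using X(4) by blast
  qed
  have in3: "x \<in> X3" if "x \<in> V j" "d < j" "j \<le> n" for x j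
  proof -
    have "x \<in> B"
      using that by (auto simp: B_def)
    then show ?thesis
      using X(5) by blast
  qed
  have K: "d \<le> j" if "x \<in> X1" "x \<in> X2" "x \<in> V j" for x j
  proof (rule ccontr)
    assume "\<not> d \<le> j"
    then have "x \<in> K"
      using that by (auto simp: K_def)
    then show False
      using that X(7) by blast
  qed
  have L: "j \<le> c" if "x \<in> X2" "x \<in> X3" "x \<in> V j" "j \<le> n" for x j
  proof (rule ccontr)
    assume "\<not> j \<le> c"
    then have "x \<in> L"
      using that by (auto simp: L_def)
    then show False
      using that X(8) by blast
  qed
  have "closed_chain P m H"
    unfolding closed_chain_def
  proof (intro conjI allI impI ballI)
    show "closed (H k)" "H k \<subseteq> P" if "k \<le> m" for k
      using V' z[OF that] clX by (auto simp: H_def)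
    show "0 < m"
      using V' by (simp add: m_def)
    show "\<exists>\<epsilon>>0. \<forall>x\<in>P. \<exists>k\<le>m. P \<inter> ball x \<epsilon> \<subseteq> H k"
    proof (intro exI[of _ "min \<delta> \<eta>"] conjI ballI)
      fix x assume x: "x \<in> P"
      then obtain j where j: "j \<le> n" "P \<inter> ball x \<delta> \<subseteq> V j"
        using \<delta> by blast
      then have xj: "x \<in> V j"
        using x \<delta> by auto
      have mid: "x \<in> P \<inter> ball x \<eta>"
        using x X(9) by auto
      \<comment> \<open>The link \<open>j\<close> occurs as \<open>j\<close> on the first leg, as
        \<open>2 * d - j\<close> on the second and as \<open>j + 2 * (d - c)\<close> on the third.
        Links before \<open>c\<close> lie in \<open>X1\<close> and links after \<open>d\<close> in
        \<open>X3\<close>, which keeps \<open>j\<close> in the range of the leg selected by the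
        piece.\<close>
      consider "P \<inter> ball x \<eta> \<subseteq> X1" | "P \<inter> ball x \<eta> \<subseteq> X2" | "P \<inter> ball x \<eta> \<subseteq> X3"
        using \<eta> x by blast
      then show "\<exists>k\<le>m. P \<inter> ball x (min \<delta> \<eta>) \<subseteq> H k"
      proof cases
        case 1
        then have "x \<in> X1"
          using mid by blast
        then have "j \<le> d"
          using in3[OF xj] X(6) j by (meson disjoint_iff not_le)
        then show ?thesis
          using 1 j cd by (intro exI[of _ j]) (auto simp: H_def X_def z_def m_def)
      next
        case 2
        then have x2: "x \<in> X2"
          using mid by blast
        have "j \<le> d"
        proof (rule ccontr)
          assume "\<not> j \<le> d"
          then show False
            using in3[OF xj] L[OF x2 _ xj] j cd by auto
        qed
        moreover have "c \<le> j"
        proof (rule ccontr)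
          assume "\<not> c \<le> j"
          then show False
            using in1[OF xj] K[OF _ x2 xj] j cd by auto
        qed
        ultimately have "z (2 * d - j) = j" "d \<le> 2 * d - j" "2 * d - j \<le> e" "2 * d - j \<le> m"
          using cd by (auto simp: z_def e_def m_def)
        moreover from this have "X2 \<subseteq> X (2 * d - j)"
          by (auto simp: X_def)
        ultimately show ?thesis
          using 2 j by (intro exI[of _ "2 * d - j"]) (auto simp: H_def)
      next
        case 3
        then have "x \<in> X3"
          using mid by blast
        then have "c \<le> j"
          using in1[OF xj] X(6) j by (meson disjoint_iff not_le)
        then have "z (j + 2 * (d - c)) = j" "e \<le> j + 2 * (d - c)" "j + 2 * (d - c) \<le> m"
          using cd j by (auto simp: z_def e_def m_def)
        moreover from this have "X3 \<subseteq> X (j + 2 * (d - c))"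
          by (auto simp: X_def)
        ultimately show ?thesis
          using 3 j by (intro exI[of _ "j + 2 * (d - c)"]) (auto simp: H_def)
      qed
    qed (use \<delta>(1) X(9) in auto)
    show "H k \<inter> H l = {}" if kl: "k \<le> m" "l \<le> m" "Suc k < l" for k l
    proof (rule ccontr)
      assume "H k \<inter> H l \<noteq> {}"
      then obtain x where x: "x \<in> H k" "x \<in> H l"
        by blast
      then have adj: "z l \<le> Suc (z k)" "z k \<le> Suc (z l)"
        using closed_chain_adjacent[OF V, of "z k" "z l" x] z kl by (auto simp: H_def)
      have zk: "x \<in> V (z k)" "x \<in> V (z l)" "z k \<le> n" "z l \<le> n"
        using x z kl by (auto simp: H_def)
      have xk: "(x \<in> X1 \<and> k \<le> d) \<or> (x \<in> X2 \<and> d \<le> k \<and> k \<le> e) \<or> (x \<in> X3 \<and> e \<le> k)"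
        using x(1) by (auto simp: H_def X_def split: if_splits)
      have xl: "(x \<in> X1 \<and> l \<le> d) \<or> (x \<in> X2 \<and> d \<le> l \<and> l \<le> e) \<or> (x \<in> X3 \<and> e \<le> l)"
        using x(2) by (auto simp: H_def X_def split: if_splits)
      have n13: "\<not> (x \<in> X1 \<and> x \<in> X3)"
        using X(6) by blast
      \<comment> \<open>Either both indices lie on one leg, where adjacency in \<open>V\<close>
        bounds their difference, or \<open>x\<close> lies in two neighbouring pieces and both
        indices are forced to the turn between them.\<close>
      consider "l \<le> d" | "d \<le> k" "l \<le> e" | "e \<le> k"
        | "k \<le> d" "d \<le> l" "l \<le> e" "x \<in> X1" "x \<in> X2"
        | "d \<le> k" "k \<le> e" "e \<le> l" "x \<in> X2" "x \<in> X3"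
        using xk xl n13 kl(3) by linarith
      then show False
      proof cases
        case 4
        then have "d \<le> z k" "d \<le> z l"
          using K zk by blast+
        then show ?thesis
          using 4 kl cd by (auto simp: z_def split: if_splits)
      next
        case 5
        then have "z k \<le> c" "z l \<le> c"
          using L zk by blast+
        then show ?thesis
          using 5 kl cd by (auto simp: z_def e_def split: if_splits)
      qed (use kl adj cd in \<open>auto simp: z_def e_def split: if_splits\<close>)
    qed
    show "\<exists>a\<in>H 0. \<forall>k\<le>m. a \<in> H k \<longrightarrow> k = 0"
    proof (intro bexI[of _ a] allI impI)
      have a1: "a \<in> X1"
        using X by (auto simp: A_def)
      then show "a \<in> H 0"
        using a by (auto simp: H_def X_def z_def)
      fix k assume k: "k \<le> m" "a \<in> H k"
      then have zk: "z k = 0"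
        using a(2)[rule_format, of "z k"] z by (auto simp: H_def)
      moreover have "a \<notin> X3"
        using a1 X(6) by blast
      moreover have "a \<notin> X2"
        using a1 X(7) AK by (auto simp: A_def)
      ultimately show "k = 0"
        using k by (auto simp: H_def X_def z_def split: if_splits)
    qed
    show "\<exists>b\<in>H m. \<forall>k\<le>m. b \<in> H k \<longrightarrow> k = m"
    proof (intro bexI[of _ b] allI impI)
      have b3: "b \<in> X3"
        using X by (auto simp: B_def)
      then show "b \<in> H m"
        using b cd by (auto simp: H_def X_def z_def m_def e_def)
      fix k assume k: "k \<le> m" "b \<in> H k"
      then have zk: "z k = n"
        using b(2)[rule_format, of "z k"] z by (auto simp: H_def)
      moreover have "b \<notin> X1"
        using b3 X(6) by blast
      moreover have "b \<notin> X2"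
        using b3 X(8) BL by (auto simp: B_def)
      ultimately have "e \<le> k"
        using k by (auto simp: H_def X_def split: if_splits)
      then show "k = m"
        using zk cd k by (auto simp: z_def m_def e_def split: if_splits)
    qed
  qed
  moreover have "\<forall>k\<le>m. H k \<subseteq> V (z k)"
    by (simp add: H_def)
  ultimately show ?thesis
    unfolding m_def z_def e_def by blast
qed

subsection \<open>Lifting chains through walks\<close>

lemma walk_bound: "walk m n s \<Longrightarrow> k \<le> m \<Longrightarrow> s k \<le> n"
  by (simp add: walk_def)

lemma walk_step: "walk m n s \<Longrightarrow> k < m \<Longrightarrow> s (Suc k) \<le> Suc (s k) \<and> s k \<le> Suc (s (Suc k))"
  by (simp add: walk_def)

lemma walk_adjacent:
  assumes "walk m n s" "i \<le> m" "j \<le> m" "i \<le> Suc j" "j \<le> Suc i"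
  shows "s i \<le> Suc (s j)"
proof -
  consider "i = j" | "i = Suc j" | "j = Suc i"
    using assms by linarith
  then show ?thesis
    using walk_step[OF assms(1)] assms by cases auto
qed

text \<open>A sequence with steps of size one that never returns to the value two steps earlier
  keeps its direction. The falling case is stated additively to avoid truncated subtraction.\<close>

lemma linear_without_turns:
  fixes s :: "nat \<Rightarrow> nat"
  assumes step: "\<And>k. p \<le> k \<Longrightarrow> k < q \<Longrightarrow> s (Suc k) = Suc (s k) \<or> s k = Suc (s (Suc k))"
    and turn: "\<And>k. p < k \<Longrightarrow> k < q \<Longrightarrow> s (Suc k) \<noteq> s (k - 1)"
  shows "(\<forall>k. p \<le> k \<and> k \<le> q \<longrightarrow> s k = s p + (k - p)) \<or> (\<forall>k. p \<le> k \<and> k \<le> q \<longrightarrow> s k + (k - p) = s p)"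
proof -
  have "q' \<le> q \<Longrightarrow> (\<forall>k. p \<le> k \<and> k \<le> q' \<longrightarrow> s k = s p + (k - p)) \<or> (\<forall>k. p \<le> k \<and> k \<le> q' \<longrightarrow> s k + (k - p) = s p)" for q'
  proof (induction q')
    case 0
    then show ?case by auto
  next
    case (Suc r)
    show ?case
    proof (cases "Suc r \<le> p")
      case True
      have "s k = s p + (k - p)" if "p \<le> k \<and> k \<le> Suc r" for k
      proof -
        have "k = p"
          using that True by simp
        then show ?thesis
          by simp
      qed
      then show ?thesis
        by blast
    next
      case pr: False
      have IH: "(\<forall>k. p \<le> k \<and> k \<le> r \<longrightarrow> s k = s p + (k - p)) \<or> (\<forall>k. p \<le> k \<and> k \<le> r \<longrightarrow> s k + (k - p) = s p)"
        using Suc by simp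
      show ?thesis
      proof (cases "r = p")
        case True
        have st: "s (Suc p) = Suc (s p) \<or> s p = Suc (s (Suc p))"
          using step[of p] Suc.prems True by simp
        have kp: "k = p \<or> k = Suc p" if "p \<le> k \<and> k \<le> Suc r" for k
          using that True by linarith
        from st show ?thesis
        proof
          assume "s (Suc p) = Suc (s p)"
          then have "s k = s p + (k - p)" if "p \<le> k \<and> k \<le> Suc r" for k
            using kp[OF that] by (elim disjE) simp_all
          then show ?thesis
            by blast
        next
          assume "s p = Suc (s (Suc p))"
          then have "s k + (k - p) = s p" if "p \<le> k \<and> k \<le> Suc r" for k
            using kp[OF that] by (elim disjE) simp_all
          then show ?thesis
            by blast
        qed
      next
        case False
        then have r: "p < r" "r < q"
          using pr Suc.prems by auto
        have st: "s (Suc r) = Suc (s r) \<or> s r = Suc (s (Suc r))" "s (Suc r) \<noteq> s (r - 1)"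
          using step[of r] turn[of r] r by auto
        from IH show ?thesis
        proof
          assume up: "\<forall>k. p \<le> k \<and> k \<le> r \<longrightarrow> s k = s p + (k - p)"
          have "s r = s p + (r - p)" "s (r - 1) = s p + (r - 1 - p)"
            by (rule up[rule_format], use r in linarith)+
          then have "s (Suc r) = s p + (Suc r - p)"
            using st r by linarith
          then have "\<forall>k. p \<le> k \<and> k \<le> Suc r \<longrightarrow> s k = s p + (k - p)"
            using up by (metis le_Suc_eq)
          then show ?thesis ..
        next
          assume down: "\<forall>k. p \<le> k \<and> k \<le> r \<longrightarrow> s k + (k - p) = s p"
          have "s r + (r - p) = s p" "s (r - 1) + (r - 1 - p) = s p"
            by (rule down[rule_format], use r in linarith)+
          then have "s (Suc r) + (Suc r - p) = s p"
            using st r by linarith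
          then have "\<forall>k. p \<le> k \<and> k \<le> Suc r \<longrightarrow> s k + (k - p) = s p"
            using down by (metis le_Suc_eq)
          then show ?thesis ..
        qed
      qed
    qed
  qed
  from this[OF order_refl] show ?thesis .
qed

text \<open>A walk without stutters from one end to the other is either monotone or contains a leg
  between two turns that is no longer than either of its neighbours, which may therefore be folded
  away. A shortest leg between two turns has this property: it is not longer than an initial or final leg
  because the walk starts at its minimum and ends at its maximum.\<close>

lemma walk_foldable_leg:
  assumes s: "walk m n s" "s 0 = 0" "s m = n"
    and step: "\<And>k. k < m \<Longrightarrow> s (Suc k) \<noteq> s k"
    and down: "p < m" "s (Suc p) < s p"
  obtains c d where "c < d" "d + 2 * (d - c) \<le> m"
    "\<forall>k. c \<le> k \<and> k \<le> d \<longrightarrow> s (2 * d - k) = s k"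
    "\<forall>k. d \<le> k \<and> k \<le> d + (d - c) \<longrightarrow> s (2 * (d + (d - c)) - k) = s k"
proof -
  have st: "s (Suc k) = Suc (s k) \<or> s k = Suc (s (Suc k))" if "k < m" for k
    using walk_step[OF s(1) that] step[OF that] by linarith
  have bound: "s k \<le> n" if "k \<le> m" for k
    using walk_bound[OF s(1) that] .
  \<comment> \<open>As there are no stutters, these are exactly the interior peaks and
    valleys.\<close>
  define T where "T = {i. 0 < i \<and> i < m \<and> s (Suc i) = s (i - 1)}"
  have noturn: "s (Suc k) \<noteq> s (k - 1)" if "k \<notin> T" "0 < k" "k < m" for k
    using that by (auto simp: T_def)
  \<comment> \<open>A walk that starts at its minimum must have risen before it falls at
    \<open>p\<close>, and must rise again afterwards to end at its maximum. So there is a turn on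
    each side of this fall.\<close>
  have "\<exists>i\<in>T. i \<le> p"
  proof (rule ccontr)
    assume "\<not> ?thesis"
    then have "(\<forall>k. 0 \<le> k \<and> k \<le> Suc p \<longrightarrow> s k = s 0 + (k - 0)) \<or> (\<forall>k. 0 \<le> k \<and> k \<le> Suc p \<longrightarrow> s k + (k - 0) = s 0)"
      using down(1) st by (intro linear_without_turns) (auto simp: T_def)
    then have "s p = p \<and> s (Suc p) = Suc p \<or> s (Suc p) + Suc p = 0"
    proof
      assume h: "\<forall>k. 0 \<le> k \<and> k \<le> Suc p \<longrightarrow> s k = s 0 + (k - 0)"
      show ?thesis
        using h[rule_format, of p] h[rule_format, of "Suc p"] s(2) by simp
    next
      assume h: "\<forall>k. 0 \<le> k \<and> k \<le> Suc p \<longrightarrow> s k + (k - 0) = s 0"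
      show ?thesis
        using h[rule_format, of "Suc p"] s(2) by simp
    qed
    then show False
      using down(2) by auto
  qed
  then obtain i0 where i0: "i0 \<in> T" "i0 \<le> p"
    by blast
  have "\<exists>j\<in>T. p < j"
  proof (rule ccontr)
    assume "\<not> ?thesis"
    then have "(\<forall>k. p \<le> k \<and> k \<le> m \<longrightarrow> s k = s p + (k - p)) \<or> (\<forall>k. p \<le> k \<and> k \<le> m \<longrightarrow> s k + (k - p) = s p)"
      using st by (intro linear_without_turns) (auto simp: T_def)
    then show False
    proof
      assume h: "\<forall>k. p \<le> k \<and> k \<le> m \<longrightarrow> s k = s p + (k - p)"
      have "s (Suc p) = s p + 1"
        using h[rule_format, of "Suc p"] down(1) by simp
      then show False
        using down(2) by simp
    next
      assume h: "\<forall>k. p \<le> k \<and> k \<le> m \<longrightarrow> s k + (k - p) = s p"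
      have "s m + (m - p) = s p"
        using h[rule_format, of m] down(1) by simp
      then show False
        using down(1) s(3) bound[of p] by auto
    qed
  qed
  then obtain j0 where j0: "j0 \<in> T" "p < j0"
    by blast
  \<comment> \<open>The least distance between two turns: no turn lies inside the chosen leg, nor at
    distance less than \<open>L\<close> beyond either of its ends.\<close>
  define Q where "Q L \<longleftrightarrow> (\<exists>i\<in>T. i + L \<in> T \<and> 0 < L)" for L
  have "Q (j0 - i0)"
    unfolding Q_def using i0 j0 by (intro bexI[of _ i0]) auto
  then have QL: "Q (Least Q)"
    by (rule LeastI)
  define L where "L = Least Q"
  obtain i where i: "i \<in> T" "i + L \<in> T" "0 < L"
    using QL unfolding L_def[symmetric] Q_def by blast
  define j where "j = i + L"
  have jT: "j \<in> T" and im: "0 < i" "j < m" "i < j"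
    using i by (auto simp: j_def T_def)
  have far: "k \<notin> T" if "i - L < k" "k < i" for k
  proof
    assume "k \<in> T"
    then have "Q (i - k)"
      unfolding Q_def using i that by (intro bexI[of _ k]) auto
    then have "L \<le> i - k"
      unfolding L_def by (rule Least_le)
    then show False
      using that by linarith
  qed
  have mid: "k \<notin> T" if "i < k" "k < j" for k
  proof
    assume "k \<in> T"
    then have "Q (k - i)"
      unfolding Q_def using i that by (intro bexI[of _ i]) auto
    then have "L \<le> k - i"
      unfolding L_def by (rule Least_le)
    then show False
      using that by (auto simp: j_def)
  qed
  have far': "k \<notin> T" if "j < k" "k < j + L" for k
  proof
    assume "k \<in> T"
    then have "Q (k - j)"
      unfolding Q_def using jT that by (intro bexI[of _ j]) auto
    then have "L \<le> k - j"
      unfolding L_def by (rule Least_le)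
    then show False
      using that by auto
  qed
  \<comment> \<open>The neighbouring stretches are provisionally truncated at \<open>0\<close> and
    at \<open>m\<close>. The facts \<open>Li\<close> and \<open>jm\<close> below show that no
    truncation takes place.\<close>
  define p0 where "p0 = i - L"
  define q0 where "q0 = min m (j + L)"
  have pq: "p0 < i" "j < q0" "q0 \<le> m"
    using i im by (auto simp: p0_def q0_def)
  have l1: "(\<forall>k. p0 \<le> k \<and> k \<le> i \<longrightarrow> s k = s p0 + (k - p0)) \<or> (\<forall>k. p0 \<le> k \<and> k \<le> i \<longrightarrow> s k + (k - p0) = s p0)"
  proof (rule linear_without_turns)
    show "s (Suc k) = Suc (s k) \<or> s k = Suc (s (Suc k))" if "p0 \<le> k" "k < i" for k
      by (rule st) (use that im in linarith)
    show "s (Suc k) \<noteq> s (k - 1)" if "p0 < k" "k < i" for k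
      by (rule noturn[OF far]) (use that im in \<open>auto simp: p0_def\<close>)
  qed
  have l2: "(\<forall>k. i \<le> k \<and> k \<le> j \<longrightarrow> s k = s i + (k - i)) \<or> (\<forall>k. i \<le> k \<and> k \<le> j \<longrightarrow> s k + (k - i) = s i)"
  proof (rule linear_without_turns)
    show "s (Suc k) = Suc (s k) \<or> s k = Suc (s (Suc k))" if "i \<le> k" "k < j" for k
      by (rule st) (use that im in linarith)
    show "s (Suc k) \<noteq> s (k - 1)" if "i < k" "k < j" for k
      by (rule noturn[OF mid]) (use that im in auto)
  qed
  have l3: "(\<forall>k. j \<le> k \<and> k \<le> q0 \<longrightarrow> s k = s j + (k - j)) \<or> (\<forall>k. j \<le> k \<and> k \<le> q0 \<longrightarrow> s k + (k - j) = s j)"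
  proof (rule linear_without_turns)
    show "s (Suc k) = Suc (s k) \<or> s k = Suc (s (Suc k))" if "j \<le> k" "k < q0" for k
      by (rule st) (use that pq in linarith)
    show "s (Suc k) \<noteq> s (k - 1)" if "j < k" "k < q0" for k
      by (rule noturn[OF far']) (use that in \<open>auto simp: q0_def\<close>)
  qed
  have ti: "s (Suc i) = s (i - 1)" and tj: "s (Suc j) = s (j - 1)"
    using i(1) jT by (auto simp: T_def)
  have ij: "s (Suc i) \<noteq> s i" "s (Suc j) \<noteq> s j"
    using step im by auto
  \<comment> \<open>In case \<open>up\<close> the walk rises to a peak at \<open>i\<close>, falls to
    \<open>j\<close> and rises again; \<open>down\<close> is the mirror image with a valley at
    \<open>i\<close>.\<close>
  consider
    (up) "\<forall>k. p0 \<le> k \<and> k \<le> i \<longrightarrow> s k + (i - k) = s i" "\<forall>k. i \<le> k \<and> k \<le> j \<longrightarrow> s k + (k - i) = s i"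
      "\<forall>k. j \<le> k \<and> k \<le> q0 \<longrightarrow> s k = s j + (k - j)"
    | (down) "\<forall>k. p0 \<le> k \<and> k \<le> i \<longrightarrow> s k = s i + (i - k)" "\<forall>k. i \<le> k \<and> k \<le> j \<longrightarrow> s k = s i + (k - i)"
      "\<forall>k. j \<le> k \<and> k \<le> q0 \<longrightarrow> s k + (k - j) = s j"
  proof (cases "s (Suc i) = Suc (s i)")
    case True
    have A: "\<forall>k. i \<le> k \<and> k \<le> j \<longrightarrow> s k = s i + (k - i)"
    proof -
      have "\<not> (\<forall>k. i \<le> k \<and> k \<le> j \<longrightarrow> s k + (k - i) = s i)"
      proof
        assume h: "\<forall>k. i \<le> k \<and> k \<le> j \<longrightarrow> s k + (k - i) = s i"
        show False
          using h[rule_format, of "Suc i"] im True by simp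
      qed
      then show ?thesis
        using l2 by blast
    qed
    have B: "\<forall>k. p0 \<le> k \<and> k \<le> i \<longrightarrow> s k + (k - p0) = s p0"
    proof -
      have "\<not> (\<forall>k. p0 \<le> k \<and> k \<le> i \<longrightarrow> s k = s p0 + (k - p0))"
      proof
        assume h: "\<forall>k. p0 \<le> k \<and> k \<le> i \<longrightarrow> s k = s p0 + (k - p0)"
        have "s i = s p0 + (i - p0)" "s (i - 1) = s p0 + (i - 1 - p0)"
          using h[rule_format, of i] h[rule_format, of "i - 1"] pq by auto
        then show False
          using ti True by linarith
      qed
      then show ?thesis
        using l1 by blast
    qed
    have B': "\<forall>k. p0 \<le> k \<and> k \<le> i \<longrightarrow> s k = s i + (i - k)"
    proof (intro allI impI)
      fix k assume k: "p0 \<le> k \<and> k \<le> i"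
      have "s k + (k - p0) = s p0" "s i + (i - p0) = s p0"
        using B[rule_format, of k] B[rule_format, of i] k pq by auto
      then show "s k = s i + (i - k)"
        using k by linarith
    qed
    have C: "\<forall>k. j \<le> k \<and> k \<le> q0 \<longrightarrow> s k + (k - j) = s j"
    proof -
      have "\<not> (\<forall>k. j \<le> k \<and> k \<le> q0 \<longrightarrow> s k = s j + (k - j))"
      proof
        assume h: "\<forall>k. j \<le> k \<and> k \<le> q0 \<longrightarrow> s k = s j + (k - j)"
        have "s (Suc j) = s j + 1"
          using h[rule_format, of "Suc j"] pq by auto
        moreover have "s j = s i + (j - i)" "s (j - 1) = s i + (j - 1 - i)"
          using A[rule_format, of j] A[rule_format, of "j - 1"] im by auto
        ultimately show False
          using tj im by linarith
      qed
      then show ?thesis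
        using l3 by blast
    qed
    show ?thesis
      by (rule down[OF B' A C])
  next
    case False
    have A: "\<forall>k. i \<le> k \<and> k \<le> j \<longrightarrow> s k + (k - i) = s i"
    proof -
      have "\<not> (\<forall>k. i \<le> k \<and> k \<le> j \<longrightarrow> s k = s i + (k - i))"
      proof
        assume h: "\<forall>k. i \<le> k \<and> k \<le> j \<longrightarrow> s k = s i + (k - i)"
        have "s (Suc i) = s i + 1"
          using h[rule_format, of "Suc i"] im by auto
        then show False
          using False by simp
      qed
      then show ?thesis
        using l2 by blast
    qed
    have Suci: "s i = Suc (s (Suc i))"
      using A[rule_format, of "Suc i"] im by auto
    have B: "\<forall>k. p0 \<le> k \<and> k \<le> i \<longrightarrow> s k = s p0 + (k - p0)"
    proof -
      have "\<not> (\<forall>k. p0 \<le> k \<and> k \<le> i \<longrightarrow> s k + (k - p0) = s p0)"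
      proof
        assume h: "\<forall>k. p0 \<le> k \<and> k \<le> i \<longrightarrow> s k + (k - p0) = s p0"
        have "s i + (i - p0) = s p0" "s (i - 1) + (i - 1 - p0) = s p0"
          using h[rule_format, of i] h[rule_format, of "i - 1"] pq by auto
        then show False
          using ti Suci pq by linarith
      qed
      then show ?thesis
        using l1 by blast
    qed
    have B': "\<forall>k. p0 \<le> k \<and> k \<le> i \<longrightarrow> s k + (i - k) = s i"
    proof (intro allI impI)
      fix k assume k: "p0 \<le> k \<and> k \<le> i"
      have "s k = s p0 + (k - p0)" "s i = s p0 + (i - p0)"
        using B[rule_format, of k] B[rule_format, of i] k pq by auto
      then show "s k + (i - k) = s i"
        using k by linarith
    qed
    have C: "\<forall>k. j \<le> k \<and> k \<le> q0 \<longrightarrow> s k = s j + (k - j)"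
    proof -
      have "\<not> (\<forall>k. j \<le> k \<and> k \<le> q0 \<longrightarrow> s k + (k - j) = s j)"
      proof
        assume h: "\<forall>k. j \<le> k \<and> k \<le> q0 \<longrightarrow> s k + (k - j) = s j"
        have "s (Suc j) + 1 = s j"
          using h[rule_format, of "Suc j"] pq by auto
        moreover have "s j + (j - i) = s i" "s (j - 1) + (j - 1 - i) = s i"
          using A[rule_format, of j] A[rule_format, of "j - 1"] im by auto
        ultimately show False
          using tj im by linarith
      qed
      then show ?thesis
        using l3 by blast
    qed
    show ?thesis
      by (rule up[OF B' A C])
  qed
  note shape = this
  \<comment> \<open>In case \<open>up\<close> a truncated initial leg would give
    \<open>s i = i < L\<close>, too low for a fall of length \<open>L\<close>. In case
    \<open>down\<close> it would start above \<open>0\<close>.\<close>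
  have Li: "L \<le> i"
  proof (rule ccontr)
    assume "\<not> L \<le> i"
    then have p0: "p0 = 0" "i < L"
      by (auto simp: p0_def)
    from shape show False
    proof cases
      case up
      have "s 0 + i = s i" "s j + L = s i"
        using up(1)[rule_format, of 0] up(2)[rule_format, of j] p0 im by (auto simp: j_def)
      then show False
        using p0 s(2) by linarith
    next
      case down
      have "s 0 = s i + i"
        using down(1)[rule_format, of 0] p0 im by auto
      then show False
        using s(2) im by linarith
    qed
  qed
  have jm: "j + L \<le> m"
  proof (rule ccontr)
    assume "\<not> j + L \<le> m"
    then have q0: "q0 = m" "m < j + L"
      by (auto simp: q0_def)
    from shape show False
    proof cases
      case up
      have "s m = s j + (m - j)" "s j + L = s i"
        using up(3)[rule_format, of m] up(2)[rule_format, of j] q0 im by (auto simp: j_def)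
      then show False
        using q0 s(3) bound[of i] im by linarith
    next
      case down
      have "s m + (m - j) = s j"
        using down(3)[rule_format, of m] q0 im by auto
      then show False
        using s(3) im bound[of j] by linarith
    qed
  qed
  have pq': "p0 + L = i" "q0 = j + L"
    using Li jm by (auto simp: p0_def q0_def)
  show ?thesis
  proof (rule that[of p0 i])
    show "p0 < i"
      using pq by simp
    show "i + 2 * (i - p0) \<le> m"
      using jm pq' by (auto simp: j_def)
    show "\<forall>k. p0 \<le> k \<and> k \<le> i \<longrightarrow> s (2 * i - k) = s k"
    proof (intro allI impI)
      fix k assume k: "p0 \<le> k \<and> k \<le> i"
      have r: "i \<le> 2 * i - k \<and> 2 * i - k \<le> j" "2 * i - k - i = i - k"
        using k pq' by (auto simp: j_def)
      from shape show "s (2 * i - k) = s k"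
      proof cases
        case up
        have "s k + (i - k) = s i" "s (2 * i - k) + (2 * i - k - i) = s i"
          using up(1)[rule_format, of k] up(2)[rule_format, of "2 * i - k"] k r by simp_all
        then show ?thesis using r by linarith
      next
        case down
        have "s k = s i + (i - k)" "s (2 * i - k) = s i + (2 * i - k - i)"
          using down(1)[rule_format, of k] down(2)[rule_format, of "2 * i - k"] k r by simp_all
        then show ?thesis using r by linarith
      qed
    qed
    show "\<forall>k. i \<le> k \<and> k \<le> i + (i - p0) \<longrightarrow> s (2 * (i + (i - p0)) - k) = s k"
    proof (intro allI impI)
      fix k assume that: "i \<le> k \<and> k \<le> i + (i - p0)"
      have ij: "i + (i - p0) = j"
        using pq' by (auto simp: j_def)
      have k: "i \<le> k \<and> k \<le> j"
        using that ij by simp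
      have r: "j \<le> 2 * j - k \<and> 2 * j - k \<le> q0" "2 * j - k - j = j - k"
        using k pq' by (auto simp: j_def)
      from shape show "s (2 * (i + (i - p0)) - k) = s k"
        unfolding ij
      proof cases
        case up
        have "s k + (k - i) = s i" "s j + (j - i) = s i" "s (2 * j - k) = s j + (2 * j - k - j)"
          using up(2)[rule_format, of k] up(2)[rule_format, of j] up(3)[rule_format, of "2 * j - k"] k r im by simp_all
        then show "s (2 * j - k) = s k" using r k by linarith
      next
        case down
        have "s k = s i + (k - i)" "s j = s i + (j - i)" "s (2 * j - k) + (2 * j - k - j) = s j"
          using down(2)[rule_format, of k] down(2)[rule_format, of j] down(3)[rule_format, of "2 * j - k"] k r im by simp_all
        then show "s (2 * j - k) = s k" using r k by linarith
      qed
    qed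
  qed
qed

lemma walk_drop_stutter:
  assumes s: "walk m n s" and i: "i < m" "s (Suc i) = s i"
  shows "walk (m - 1) n (\<lambda>k. if k \<le> i then s k else s (Suc k))"
  unfolding walk_def
proof (intro conjI allI impI)
  fix k assume "k \<le> m - 1"
  then show "(if k \<le> i then s k else s (Suc k)) \<le> n"
    using walk_bound[OF s] i by auto
next
  fix k assume k: "k < m - 1"
  then have "s (Suc k) \<le> Suc (s k) \<and> s k \<le> Suc (s (Suc k))"
    "s (Suc (Suc k)) \<le> Suc (s (Suc k)) \<and> s (Suc k) \<le> Suc (s (Suc (Suc k)))"
    using walk_step[OF s, of k] walk_step[OF s, of "Suc k"] by auto
  moreover have "k = i \<or> Suc k \<le> i \<or> i < k"
    by linarith
  ultimately show "(if Suc k \<le> i then s (Suc k) else s (Suc (Suc k))) \<le> Suc (if k \<le> i then s k else s (Suc k))"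
    "(if k \<le> i then s k else s (Suc k)) \<le> Suc (if Suc k \<le> i then s (Suc k) else s (Suc (Suc k)))"
    using i by auto
qed

lemma walk_drop_zigzag:
  assumes s: "walk m n s" and d: "d + 2 * r \<le> m" "s (d + 2 * r) = s d"
  shows "walk (m - 2 * r) n (\<lambda>k. if k \<le> d then s k else s (k + 2 * r))"
  unfolding walk_def
proof (intro conjI allI impI)
  fix k assume "k \<le> m - 2 * r"
  then show "(if k \<le> d then s k else s (k + 2 * r)) \<le> n"
    using walk_bound[OF s] d by auto
next
  fix k assume k: "k < m - 2 * r"
  then have "s (Suc k) \<le> Suc (s k) \<and> s k \<le> Suc (s (Suc k))"
    "s (Suc (k + 2 * r)) \<le> Suc (s (k + 2 * r)) \<and> s (k + 2 * r) \<le> Suc (s (Suc (k + 2 * r)))"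
    using walk_step[OF s, of k] walk_step[OF s, of "k + 2 * r"] by auto
  moreover have "k = d \<or> Suc k \<le> d \<or> d < k"
    by linarith
  ultimately show "(if Suc k \<le> d then s (Suc k) else s (Suc k + 2 * r)) \<le> Suc (if k \<le> d then s k else s (k + 2 * r))"
    "(if k \<le> d then s k else s (k + 2 * r)) \<le> Suc (if Suc k \<le> d then s (Suc k) else s (Suc k + 2 * r))"
    using d by auto
qed

text \<open>Strong induction on the length of the walk: remove a stutter or a foldable zigzag, lift
  the shorter walk, and put the removed part back by \<open>closed_chain_stutter\<close> or
  \<open>closed_chain_zigzag\<close>. The end conditions survive each removal, and they are what
  guarantees a foldable leg as soon as the walk descends.\<close>

lemma closed_chain_lift_ends:
  assumes P: "compact P" "hereditarily_indecomposable P" and V: "closed_chain P n V"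
    and s: "walk m n s" "s 0 = 0" "s m = n"
  shows "\<exists>H. closed_chain P m H \<and> (\<forall>k\<le>m. H k \<subseteq> V (s k))"
  using s
proof (induction m arbitrary: s rule: less_induct)
  case (less m)
  consider (stutter) i where "i < m" "s (Suc i) = s i"
    | (down) p where "\<And>k. k < m \<Longrightarrow> s (Suc k) \<noteq> s k" "p < m" "s (Suc p) < s p"
    | (up) "\<And>k. k < m \<Longrightarrow> s (Suc k) = Suc (s k)"
    using walk_step[OF less.prems(1)] by (metis le_SucE le_antisym not_less)
  then show ?case
  proof cases
    case stutter
    define s' where "s' k = (if k \<le> i then s k else s (Suc k))" for k
    have "walk (m - 1) n s'"
      unfolding s'_def using walk_drop_stutter[OF less.prems(1) stutter] .
    moreover have "s' 0 = 0"
      using less.prems by (simp add: s'_def)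
    moreover have "s' (m - 1) = n"
      using less.prems stutter by (cases "m - 1 = i") (auto simp: s'_def)
    ultimately obtain H where H: "closed_chain P (m - 1) H" "\<forall>k\<le>m - 1. H k \<subseteq> V (s' k)"
      using less.IH[of "m - 1" s'] stutter by auto
    have m: "Suc (m - 1) = m" and im: "i \<le> m - 1"
      using stutter by auto
    obtain G where G: "closed_chain P m G" "\<forall>k\<le>m. G k \<subseteq> H (if k \<le> i then k else k - 1)"
      using closed_chain_stutter[OF P(1) H(1) im] unfolding m by blast
    have "G k \<subseteq> V (s k)" if k: "k \<le> m" for k
    proof -
      define z where "z = (if k \<le> i then k else k - 1)"
      have "z \<le> m - 1"
        using k stutter by (auto simp: z_def)
      moreover have "s' z = s k"
      proof (cases "k = Suc i")
        case True
        then show ?thesis using stutter by (simp add: s'_def z_def)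
      next
        case False
        then show ?thesis by (auto simp: s'_def z_def)
      qed
      moreover have "G k \<subseteq> H z"
        using G(2) k unfolding z_def by blast
      ultimately show ?thesis
        using H(2) by (metis order_trans)
    qed
    then show ?thesis
      using G(1) by blast
  next
    case down
    obtain c d where cd: "c < d" "d + 2 * (d - c) \<le> m"
      and fold1: "\<forall>k. c \<le> k \<and> k \<le> d \<longrightarrow> s (2 * d - k) = s k"
      and fold2: "\<forall>k. d \<le> k \<and> k \<le> d + (d - c) \<longrightarrow> s (2 * (d + (d - c)) - k) = s k"
      by (rule walk_foldable_leg[OF less.prems down])
    define r where "r = d - c"
    have r: "0 < r" "c + r = d" "d + 2 * r \<le> m"
      using cd by (auto simp: r_def)
    define s' where "s' k = (if k \<le> d then s k else s (k + 2 * r))" for k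
    have sd: "s (d + 2 * r) = s d"
      using fold2[rule_format, of d] r by (auto simp: r_def[symmetric] algebra_simps)
    have "walk (m - 2 * r) n s'"
      unfolding s'_def using walk_drop_zigzag[OF less.prems(1) r(3) sd] .
    moreover have "s' 0 = 0"
      using less.prems by (simp add: s'_def)
    moreover have "s' (m - 2 * r) = n"
    proof (cases "m - 2 * r = d")
      case True
      then have "m = d + 2 * r"
        using r by auto
      then show ?thesis
        using less.prems sd True by (auto simp: s'_def)
    next
      case False
      then show ?thesis
        using less.prems r by (auto simp: s'_def)
    qed
    ultimately obtain H where H: "closed_chain P (m - 2 * r) H" "\<forall>k\<le>m - 2 * r. H k \<subseteq> V (s' k)"
      using less.IH[of "m - 2 * r" s'] r by auto
    have m: "m - 2 * r + 2 * (d - c) = m"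
      using r by (auto simp: r_def[symmetric])
    have dm: "d \<le> m - 2 * r"
      using r by linarith
    obtain G where G: "closed_chain P m G"
      "\<forall>k\<le>m. G k \<subseteq> H (if k \<le> d then k else if k \<le> d + (d - c) then 2 * d - k else k - 2 * (d - c))"
      using closed_chain_zigzag[OF P H(1) cd(1) dm] unfolding m by blast
    have "G k \<subseteq> V (s k)" if k: "k \<le> m" for k
    proof -
      define z where "z = (if k \<le> d then k else if k \<le> d + (d - c) then 2 * d - k else k - 2 * (d - c))"
      have "z \<le> m - 2 * r"
        using k r by (auto simp: r_def[symmetric] z_def)
      moreover have "s' z = s k"
      proof -
        consider "k \<le> d" | "d < k" "k \<le> d + r" | "d + r < k" "k \<le> d + 2 * r" | "d + 2 * r < k"
          by linarith
        then show ?thesis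
        proof cases
          case 1
          then show ?thesis by (simp add: s'_def z_def)
        next
          case 2
          then have "z = 2 * d - k" "2 * d - k \<le> d" "c \<le> 2 * d - k" "2 * d - (2 * d - k) = k"
            using r by (auto simp: r_def[symmetric] z_def)
          then show ?thesis
            using fold1[rule_format, of "2 * d - k"] by (simp add: s'_def)
        next
          case 3
          then have z: "z = k - 2 * r" "k - 2 * r \<le> d"
            using r by (auto simp: r_def[symmetric] z_def)
          \<comment> \<open>On the third leg the shift by \<open>2 * r\<close> is the composition of
            the reflections in \<open>d\<close> and in \<open>d + r\<close>, both of which preserve
            \<open>s\<close>.\<close>
          have "s (2 * (d + r) - k) = s k"
          proof -
            have "s (2 * (d + r) - (2 * (d + r) - k)) = s (2 * (d + r) - k)"
              by (rule fold2[folded r_def, rule_format]) (use 3 in auto)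
            moreover have "2 * (d + r) - (2 * (d + r) - k) = k"
              using 3 by auto
            ultimately show ?thesis
              by simp
          qed
          moreover have "s (2 * d - (k - 2 * r)) = s (k - 2 * r)"
            using 3 r by (intro fold1[rule_format]) auto
          moreover have "2 * d - (k - 2 * r) = 2 * (d + r) - k"
          proof -
            have "2 * r \<le> k"
              using 3 r by linarith
            then obtain e where "k = 2 * r + e"
              using le_Suc_ex by blast
            then show ?thesis
              by simp
          qed
          ultimately have "s (k - 2 * r) = s k"
            by simp
          then show ?thesis
            unfolding z(1) using z(2) by (simp add: s'_def)
        next
          case 4
          then have z: "z = k - 2 * r" "\<not> k - 2 * r \<le> d" "k - 2 * r + 2 * r = k"
            using r by (auto simp: r_def[symmetric] z_def)
          show ?thesis
            unfolding z(1) using z(2,3) by (simp add: s'_def)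
        qed
      qed
      moreover have "G k \<subseteq> H z"
        using G(2) k unfolding z_def by blast
      ultimately show ?thesis
        using H(2) by (metis order_trans)
    qed
    then show ?thesis
      using G(1) by blast
  next
    case up
    \<comment> \<open>A walk that always rises is the identity, so \<open>m = n\<close> and the
      chain \<open>V\<close> is its own lift.\<close>
    have "s k = k" if "k \<le> m" for k
      using that up less.prems(2) by (induction k) auto
    then show ?thesis
      using V less.prems(3) by (intro exI[of _ V]) auto
  qed
qed

lemma walk_comp:
  assumes "walk M m \<kappa>" "walk m n s"
  shows "walk M n (\<lambda>t. s (\<kappa> t))"
  unfolding walk_def
proof (intro conjI allI impI)
  show "s (\<kappa> t) \<le> n" if "t \<le> M" for t
    using that walk_bound[OF assms(1)] walk_bound[OF assms(2)] by simp
  fix t assume "t < M"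
  then have "\<kappa> (Suc t) \<le> m" "\<kappa> t \<le> m" "\<kappa> (Suc t) \<le> Suc (\<kappa> t)" "\<kappa> t \<le> Suc (\<kappa> (Suc t))"
    using walk_bound[OF assms(1)] walk_step[OF assms(1)] by simp_all
  then show "s (\<kappa> (Suc t)) \<le> Suc (s (\<kappa> t))" "s (\<kappa> t) \<le> Suc (s (\<kappa> (Suc t)))"
    using walk_adjacent[OF assms(2)] by blast+
qed

text \<open>Unions over the fibres of \<open>\<kappa>\<close> again form a chain: adjacent fine
  indices have adjacent images, and a private point of a fine link lies in only one coarse
  link.\<close>

lemma closed_chain_coarsen:
  assumes P: "connected P" and H: "closed_chain P M H" and \<kappa>: "walk M m \<kappa>"
    and onto: "\<forall>i\<le>m. \<exists>j\<le>M. \<kappa> j = i" and m: "0 < m"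
  shows "closed_chain P m (\<lambda>i. \<Union>j\<in>{j. j \<le> M \<and> \<kappa> j = i}. H j)"
proof -
  let ?G = "\<lambda>i. \<Union>j\<in>{j. j \<le> M \<and> \<kappa> j = i}. H j"
  have H': "\<forall>j\<le>M. closed (H j) \<and> H j \<subseteq> P"
    using H by (simp add: closed_chain_def)
  have priv: "\<exists>x\<in>?G i. \<forall>i'\<le>m. x \<in> ?G i' \<longrightarrow> i' = i" if i: "i \<le> m" for i
  proof -
    obtain j where j: "j \<le> M" "\<kappa> j = i"
      using onto[rule_format, OF i] by blast
    obtain x where x: "x \<in> H j" "\<forall>j'\<le>M. x \<in> H j' \<longrightarrow> j' = j"
      using closed_chain_private[OF P H j(1)] by blast
    have only: "i' = i" if i': "x \<in> ?G i'" for i'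
    proof -
      obtain j' where j': "j' \<le> M" "\<kappa> j' = i'" "x \<in> H j'"
        using i' by auto
      then have "j' = j"
        using x(2) by blast
      then show ?thesis
        using j j' by simp
    qed
    show ?thesis
    proof (intro bexI[of _ x] allI impI)
      show "x \<in> ?G i"
        using j x(1) by auto
    qed (rule only)
  qed
  show ?thesis
    unfolding closed_chain_def
  proof (intro conjI allI impI ballI)
    show "0 < m"
      by (rule m)
    show "closed (?G i)" if "i \<le> m" for i
      by (rule closed_UN) (use H' in auto)
    show "?G i \<subseteq> P" if "i \<le> m" for i
      using H' by blast
    obtain \<delta> where \<delta>: "\<delta> > 0" "\<forall>x\<in>P. \<exists>i\<le>M. P \<inter> ball x \<delta> \<subseteq> H i"
      by (rule closed_chain_lebesgue[OF H])
    show "\<exists>\<delta>>0. \<forall>x\<in>P. \<exists>i\<le>m. P \<inter> ball x \<delta> \<subseteq> ?G i"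
    proof (intro exI[of _ \<delta>] conjI ballI)
      fix x assume "x \<in> P"
      then obtain j where j: "j \<le> M" "P \<inter> ball x \<delta> \<subseteq> H j"
        using \<delta> by blast
      then show "\<exists>i\<le>m. P \<inter> ball x \<delta> \<subseteq> ?G i"
        using walk_bound[OF \<kappa>] by (intro exI[of _ "\<kappa> j"]) blast
    qed (rule \<delta>(1))
    show "?G i \<inter> ?G i' = {}" if i: "i \<le> m" "i' \<le> m" "Suc i < i'" for i i'
    proof (rule equals0I)
      fix x assume "x \<in> ?G i \<inter> ?G i'"
      then obtain j j' where j: "j \<le> M" "j' \<le> M" "\<kappa> j = i" "\<kappa> j' = i'" "x \<in> H j" "x \<in> H j'"
        by auto
      then have "\<kappa> j' \<le> Suc (\<kappa> j)"
        using closed_chain_adjacent[OF H, of j j' x] by (intro walk_adjacent[OF \<kappa>]) auto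
      then show False
        using i j by simp
    qed
    show "\<exists>a\<in>?G 0. \<forall>i\<le>m. a \<in> ?G i \<longrightarrow> i = 0" "\<exists>b\<in>?G m. \<forall>i\<le>m. b \<in> ?G i \<longrightarrow> i = m"
      by (rule priv, simp)+
  qed
qed

text \<open>A surjective walk may start and end anywhere. It is prolonged by running over its own
  index range so that it begins over \<open>0\<close> and ends over \<open>n\<close>; the lift of
  the prolonged walk is then collapsed along \<open>\<kappa>\<close>, over which \<open>s\<close>
  has not changed.\<close>

lemma closed_chain_lift:
  assumes P: "compact P" "connected P" "hereditarily_indecomposable P" and V: "closed_chain P n V"
    and s: "walk m n s" and onto: "\<forall>i\<le>n. \<exists>k\<le>m. s k = i"
  shows "\<exists>H. closed_chain P m H \<and> (\<forall>k\<le>m. H k \<subseteq> V (s k))"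
proof -
  have n: "0 < n"
    using V by (simp add: closed_chain_def)
  obtain \<alpha> where \<alpha>: "\<alpha> \<le> m" "s \<alpha> = 0"
    using onto[rule_format, of 0] by auto
  obtain \<beta> where \<beta>: "\<beta> \<le> m" "s \<beta> = n"
    using onto[rule_format, of n] by auto
  have m: "0 < m"
    using n \<alpha> \<beta> by (cases "m = 0") auto
  \<comment> \<open>The path descends from \<open>\<alpha>\<close> to \<open>0\<close>, crosses to
    \<open>m\<close> and descends to \<open>\<beta>\<close>, which it reaches at time
    \<open>M\<close>. The middle stretch makes it onto.\<close>
  define \<kappa> where "\<kappa> t = (if t \<le> \<alpha> then \<alpha> - t else if t \<le> \<alpha> + m then t - \<alpha> else \<alpha> + 2 * m - t)" for t
  define M where "M = \<alpha> + m + (m - \<beta>)"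
  have \<kappa>: "walk M m \<kappa>"
    unfolding walk_def
  proof (intro conjI allI impI)
    show "\<kappa> t \<le> m" if "t \<le> M" for t
      using that \<alpha> \<beta> by (auto simp: \<kappa>_def M_def)
    fix t
    consider "Suc t \<le> \<alpha>" | "t = \<alpha>" | "\<alpha> < t" "Suc t \<le> \<alpha> + m" | "t = \<alpha> + m" | "\<alpha> + m < t"
      by linarith
    note cases = this
    assume "t < M"
    from cases show "\<kappa> (Suc t) \<le> Suc (\<kappa> t)" "\<kappa> t \<le> Suc (\<kappa> (Suc t))"
      using m by (cases; auto simp: \<kappa>_def)+
  qed
  have "s (\<kappa> 0) = 0"
    using \<alpha> by (simp add: \<kappa>_def)
  moreover have "\<kappa> M = \<beta>"
    using m \<beta> \<alpha> by (auto simp: \<kappa>_def M_def)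
  ultimately obtain G where G: "closed_chain P M G" "\<forall>t\<le>M. G t \<subseteq> V (s (\<kappa> t))"
    using closed_chain_lift_ends[OF P(1,3) V walk_comp[OF \<kappa> s]] \<beta> by blast
  have "\<exists>t\<le>M. \<kappa> t = i" if "i \<le> m" for i
    using that by (intro exI[of _ "\<alpha> + i"]) (auto simp: \<kappa>_def M_def)
  then have "closed_chain P m (\<lambda>i. \<Union>j\<in>{j. j \<le> M \<and> \<kappa> j = i}. G j)"
    by (intro closed_chain_coarsen[OF P(2) G(1) \<kappa> _ m]) simp
  then show ?thesis
    using G(2) by (intro exI[of _ "\<lambda>i. \<Union>j\<in>{j. j \<le> M \<and> \<kappa> j = i}. G j"]) blast
qed

section \<open>Refinements and chains of small mesh\<close>

lemma refinement_walk:
  assumes P: "connected P" and W: "closed_chain P m W" and V: "closed_chain P n V"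
    and s: "\<forall>k\<le>m. s k \<le> n \<and> W k \<subseteq> V (s k)"
  shows "walk m n s" "\<forall>i\<le>n. \<exists>k\<le>m. s k = i"
proof -
  show "walk m n s"
    unfolding walk_def
  proof (intro conjI allI impI)
    fix k assume k: "k < m"
    then obtain x where x: "x \<in> W k" "x \<in> W (Suc k)"
      using closed_chain_link_Int[OF P W] by blast
    have sk: "s k \<le> n" "s (Suc k) \<le> n" "x \<in> V (s k)" "x \<in> V (s (Suc k))"
      using s[rule_format, of k] s[rule_format, of "Suc k"] k x by auto
    show "s (Suc k) \<le> Suc (s k)" "s k \<le> Suc (s (Suc k))"
      using closed_chain_adjacent[OF V sk] by blast+
  qed (use s in blast)
  show "\<forall>i\<le>n. \<exists>k\<le>m. s k = i"
  proof (intro allI impI)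
    fix i assume i: "i \<le> n"
    \<comment> \<open>A private point of \<open>V i\<close> forces any link of \<open>W\<close>
      through it to have index \<open>i\<close> under \<open>s\<close>.\<close>
    obtain x where x: "x \<in> V i" "\<forall>j\<le>n. x \<in> V j \<longrightarrow> j = i"
      using closed_chain_private[OF P V i] by blast
    moreover have "V i \<subseteq> P"
      using V i by (simp add: closed_chain_def)
    ultimately obtain k where k: "k \<le> m" "x \<in> W k"
      using closed_chain_cover[OF W, of x] by blast
    then have "s k \<le> n" "x \<in> V (s k)"
      using s by auto
    then show "\<exists>k\<le>m. s k = i"
      using x(2) k(1) by blast
  qed
qed

definition mesh_less :: "nat \<Rightarrow> (nat \<Rightarrow> 'a::metric_space set) \<Rightarrow> real \<Rightarrow> bool" where
  "mesh_less n V \<epsilon> \<longleftrightarrow> (\<forall>i\<le>n. \<forall>x\<in>V i. \<forall>y\<in>V i. dist x y < \<epsilon>)"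

lemma mesh_less_refines:
  assumes V: "closed_chain P n V"
  obtains \<delta> where "\<delta> > 0" "\<forall>S. S \<subseteq> P \<and> S \<noteq> {} \<and> (\<forall>x\<in>S. \<forall>y\<in>S. dist x y < \<delta>) \<longrightarrow> (\<exists>i\<le>n. S \<subseteq> V i)"
proof -
  obtain \<delta> where \<delta>: "\<delta> > 0" "\<forall>x\<in>P. \<exists>i\<le>n. P \<inter> ball x \<delta> \<subseteq> V i"
    by (rule closed_chain_lebesgue[OF V])
  have sub: "\<exists>i\<le>n. S \<subseteq> V i" if S: "S \<subseteq> P" "S \<noteq> {}" "\<forall>x\<in>S. \<forall>y\<in>S. dist x y < \<delta>" for S
  proof -
    obtain x where x: "x \<in> S"
      using S by blast
    then obtain i where "i \<le> n" "P \<inter> ball x \<delta> \<subseteq> V i"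
      using \<delta> S by blast
    moreover have "S \<subseteq> P \<inter> ball x \<delta>"
      using S x by auto
    ultimately show ?thesis
      by blast
  qed
  show ?thesis
    by (rule that[OF \<delta>(1)]) (intro allI impI, elim conjE, rule sub)
qed

lemma closed_chain_link_nonempty:
  assumes "connected P" "closed_chain P n V" "i \<le> n"
  shows "V i \<noteq> {}"
  using closed_chain_private[OF assms] by blast

text \<open>A Lebesgue number that in addition suits the prescribed points \<open>a\<close> and
  \<open>b\<close> in the prescribed members, so that both remain in the end links after
  shrinking.\<close>

lemma open_cover_chain_shrink:
  fixes P :: "'a::metric_space set"
  assumes P: "compact P" and ab: "a \<in> U p" "b \<in> U q" "p \<in> I" "q \<in> I"
    and U: "open_cover_of P (U ` I)"
  shows "\<exists>\<delta>>0. (\<forall>x\<in>P. \<exists>i\<in>I. P \<inter> ball x \<delta> \<subseteq> U i) \<and> P \<inter> ball a \<delta> \<subseteq> U p \<and> P \<inter> ball b \<delta> \<subseteq> U q"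
proof -
  have op: "openin (top_of_set P) (U i)" if "i \<in> I" for i
    using U that by (auto simp: open_cover_of_def)
  then have "\<forall>i\<in>I. \<exists>W. open W \<and> U i = P \<inter> W"
    by (simp add: openin_open)
  then obtain W where W: "\<forall>i\<in>I. open (W i) \<and> U i = P \<inter> W i"
    by metis
  have "P \<subseteq> \<Union> (W ` I)"
    using U W by (auto simp: open_cover_of_def)
  then obtain \<delta> where \<delta>: "0 < \<delta>" "\<And>x. x \<in> P \<Longrightarrow> \<exists>G \<in> W ` I. ball x \<delta> \<subseteq> G"
    using Heine_Borel_lemma[OF P, of "W ` I"] W by blast
  obtain da db where d: "0 < da" "ball a da \<subseteq> W p" "0 < db" "ball b db \<subseteq> W q"
    using W ab by (metis IntE openE)
  let ?d = "min \<delta> (min da db)"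
  have small: "ball z ?d \<subseteq> ball z \<delta>" "ball z ?d \<subseteq> ball z da" "ball z ?d \<subseteq> ball z db" for z :: 'a
    by auto
  show ?thesis
  proof (intro exI[of _ ?d] conjI ballI)
    show "\<exists>i\<in>I. P \<inter> ball x ?d \<subseteq> U i" if x: "x \<in> P" for x
    proof -
      obtain i where "i \<in> I" "ball x \<delta> \<subseteq> W i"
        using \<delta>(2)[OF x] by blast
      then show ?thesis
        using W small by (intro bexI[of _ i]) auto
    qed
    show "P \<inter> ball a ?d \<subseteq> U p" "P \<inter> ball b ?d \<subseteq> U q"
      using W ab d small by auto
  qed (use \<delta> d in auto)
qed

text \<open>An open chain is shrunk to closed links by a Lebesgue number. Its end links need not
  have private points after shrinking, so the first two and the last two links are merged, at the
  cost of doubling the mesh.\<close>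

lemma small_closed_chain:
  fixes P :: "'a::metric_space set"
  assumes P: "compact P" "chainable P" and xy: "x0 \<in> P" "y0 \<in> P" "x0 \<noteq> y0" and \<epsilon>: "\<epsilon> > 0"
  shows "\<exists>m W. closed_chain P m W \<and> mesh_less m W \<epsilon>"
proof -
  \<comment> \<open>The bound by \<open>\<epsilon> / 2\<close> pays for merging two links; the bound
    by a third of \<open>dist x0 y0\<close> excludes chains with fewer than four links.\<close>
  define \<eta> where "\<eta> = min (\<epsilon> / 2) (dist x0 y0 / 3)"
  have \<eta>: "0 < \<eta>" "2 * \<eta> \<le> \<epsilon>" "3 * \<eta> \<le> dist x0 y0"
    using \<epsilon> xy by (auto simp: \<eta>_def)
  let ?C = "(\<lambda>x. P \<inter> ball x (\<eta> / 2)) ` P"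
  have C: "open_cover_of P ?C"
    using \<eta>(1) by (auto simp: open_cover_of_def openin_open)
  obtain N U where U: "open_cover_of P (U ` {1..N})" "\<forall>i\<in>{1..N}. \<exists>C\<in>?C. U i \<subseteq> C"
    and meet: "\<forall>i\<in>{1..N}. \<forall>j\<in>{1..N}. U i \<inter> U j \<noteq> {} \<longleftrightarrow> \<bar>int j - int i\<bar> \<le> 1"
    using P(2)[unfolded chainable_def, rule_format, OF C] by (elim exE conjE)
  have diam: "dist x y < \<eta>" if i: "i \<in> {1..N}" and "x \<in> U i" "y \<in> U i" for i x y
  proof -
    obtain z where "U i \<subseteq> ball z (\<eta> / 2)"
      using U(2) i by blast
    then have "dist z x < \<eta> / 2" "dist z y < \<eta> / 2"
      using that by auto
    then show ?thesis
      using dist_triangle_half_r by (metis dist_commute)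
  qed
  have near: "dist x y < 2 * \<eta>" if ij: "i \<in> {1..N}" "j \<in> {1..N}" "i \<le> Suc j" "j \<le> Suc i" and x: "x \<in> U i" "y \<in> U j" for i j x y
  proof -
    have "U i \<inter> U j \<noteq> {}"
      using meet ij by auto
    then obtain z where "z \<in> U i" "z \<in> U j"
      by blast
    then have "dist x z < \<eta>" "dist z y < \<eta>"
      using diam ij x by blast+
    then show ?thesis
      using dist_triangle[of x y z] by linarith
  qed
  have cover: "\<exists>i\<in>{1..N}. x \<in> U i" if "x \<in> P" for x
    using U(1) that by (auto simp: open_cover_of_def)
  \<comment> \<open>With at most three links, the link \<open>h\<close> meets every link, so
    \<open>x0\<close> and \<open>y0\<close> are joined by three jumps shorter than
    \<open>\<eta>\<close>. Four links are what leaves two different end links after merging.\<close>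
  have N: "4 \<le> N"
  proof (rule ccontr)
    assume N: "\<not> 4 \<le> N"
    obtain i j where ij: "i \<in> {1..N}" "x0 \<in> U i" "j \<in> {1..N}" "y0 \<in> U j"
      using cover xy by meson
    define h where "h = min 2 N"
    have h: "h \<in> {1..N}" "\<bar>int h - int i\<bar> \<le> 1" "\<bar>int j - int h\<bar> \<le> 1"
      using ij N by (auto simp: h_def)
    have "U i \<inter> U h \<noteq> {}" "U h \<inter> U j \<noteq> {}"
      using meet ij h by auto
    then obtain z w where "z \<in> U i" "z \<in> U h" "w \<in> U h" "w \<in> U j"
      by blast
    then have "dist x0 z < \<eta>" "dist z w < \<eta>" "dist w y0 < \<eta>"
      using diam ij h(1) by blast+
    then show False
      using \<eta>(3) dist_triangle[of x0 y0 z] dist_triangle[of z y0 w] by linarith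
  qed
  have I: "1 \<in> {1..N}" "N \<in> {1..N}"
    using N by auto
  then have "U 1 \<inter> U 1 \<noteq> {}" "U N \<inter> U N \<noteq> {}"
    using meet by (metis abs_zero cancel_comm_monoid_add_class.diff_cancel zero_le_one)+
  then obtain a b where ab: "a \<in> U 1" "b \<in> U N"
    by blast
  obtain \<delta> where \<delta>: "\<delta> > 0" "\<forall>x\<in>P. \<exists>i\<in>{1..N}. P \<inter> ball x \<delta> \<subseteq> U i"
    "P \<inter> ball a \<delta> \<subseteq> U 1" "P \<inter> ball b \<delta> \<subseteq> U N"
    using open_cover_chain_shrink[OF P(1) ab I U(1)] by blast
  have UP: "U i \<subseteq> P" if "i \<in> {1..N}" for i
    using U(1) that by (auto simp: open_cover_of_def)
  \<comment> \<open>The points at distance at least \<open>\<delta> / 2\<close> from the rest of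
    \<open>P\<close>: a closed shrinking which still has Lebesgue number
    \<open>\<delta> / 2\<close>.\<close>
  define W where "W i = {x\<in>P. P \<inter> ball x (\<delta> / 2) \<subseteq> U i}" for i
  have WU: "W i \<subseteq> U i" for i
    using \<delta>(1) by (auto simp: W_def)
  have Wcl: "closed (W i)" for i
  proof -
    have "W i = P \<inter> (\<Inter>y\<in>P - U i. {x. \<delta> / 2 \<le> dist x y})"
      by (auto simp: W_def not_less[symmetric])
    moreover have "closed (P \<inter> (\<Inter>y\<in>P - U i. {x. \<delta> / 2 \<le> dist x y}))"
      by (intro closed_Int closed_INT ballI closed_Collect_le continuous_intros compact_imp_closed P(1))
    ultimately show ?thesis
      by simp
  qed
  have half: "P \<inter> ball x (\<delta> / 2) \<subseteq> W i" if x: "P \<inter> ball x \<delta> \<subseteq> U i" for x i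
  proof
    fix y assume y: "y \<in> P \<inter> ball x (\<delta> / 2)"
    have "ball y (\<delta> / 2) \<subseteq> ball x \<delta>"
    proof
      fix z assume "z \<in> ball y (\<delta> / 2)"
      then show "z \<in> ball x \<delta>"
        using y dist_triangle[of x z y] by auto
    qed
    then show "y \<in> W i"
      using x y by (auto simp: W_def)
  qed
  \<comment> \<open>Indices \<open>1, 2\<close> go to \<open>0\<close> and indices
    \<open>N - 1, N\<close> go to \<open>m = N - 3\<close>. The point \<open>a\<close> of
    \<open>U 1\<close> can lie in no link beyond \<open>U 2\<close>, so it becomes private; likewise
    \<open>b\<close> at the other end.\<close>
  define \<kappa> where "\<kappa> i = min (max i 2) (N - 1) - 2" for i
  define m where "m = N - 3"
  define G where "G k = (\<Union>i\<in>{i\<in>{1..N}. \<kappa> i = k}. W i)" for k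
  have G: "\<exists>i\<in>{1..N}. \<kappa> i = k \<and> x \<in> W i \<and> x \<in> U i" if x: "x \<in> G k" for x k
  proof -
    obtain i where "i \<in> {1..N}" "\<kappa> i = k" "x \<in> W i"
      using x unfolding G_def by auto
    then show ?thesis
      using WU by blast
  qed
  have \<kappa>m: "\<kappa> i \<le> m" for i
    by (auto simp: \<kappa>_def m_def)
  have adj: "i \<le> Suc j \<and> j \<le> Suc i" if "i \<in> {1..N}" "j \<in> {1..N}" "x \<in> U i" "x \<in> U j" for i j x
  proof -
    have "U i \<inter> U j \<noteq> {}"
      using that by blast
    then have "\<bar>int j - int i\<bar> \<le> 1"
      using meet that by blast
    then show ?thesis
      by linarith
  qed
  have "closed_chain P m G"
    unfolding closed_chain_def
  proof (intro conjI allI impI ballI)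
    show "0 < m"
      using N by (simp add: m_def)
    show "closed (G k)" for k
      unfolding G_def by (intro closed_UN) (use Wcl in auto)
    show "G k \<subseteq> P" for k
      by (auto simp: G_def W_def)
    show "\<exists>\<delta>>0. \<forall>x\<in>P. \<exists>k\<le>m. P \<inter> ball x \<delta> \<subseteq> G k"
    proof (intro exI[of _ "\<delta> / 2"] conjI ballI)
      fix x assume "x \<in> P"
      then obtain i where i: "i \<in> {1..N}" "P \<inter> ball x \<delta> \<subseteq> U i"
        using \<delta>(2) by blast
      have "W i \<subseteq> G (\<kappa> i)"
        using i by (auto simp: G_def)
      then show "\<exists>k\<le>m. P \<inter> ball x (\<delta> / 2) \<subseteq> G k"
        using half[OF i(2)] \<kappa>m by (intro exI[of _ "\<kappa> i"]) blast
    qed (use \<delta> in simp)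
    show "G k \<inter> G l = {}" if "Suc k < l" for k l
    proof (rule equals0I)
      fix x assume "x \<in> G k \<inter> G l"
      then obtain i j where ij: "i \<in> {1..N}" "\<kappa> i = k" "x \<in> U i" "j \<in> {1..N}" "\<kappa> j = l" "x \<in> U j"
        using G[of x k] G[of x l] by blast
      then have "i \<le> Suc j \<and> j \<le> Suc i"
        using adj by blast
      then have "\<kappa> j \<le> Suc (\<kappa> i)"
        by (auto simp: \<kappa>_def)
      then show False
        using ij that by simp
    qed
    have "a \<in> W 1" "b \<in> W N"
      using half[OF \<delta>(3)] half[OF \<delta>(4)] ab UP[OF I(1)] UP[OF I(2)] \<delta>(1) by auto
    moreover have "\<kappa> 1 = 0" "\<kappa> N = m"
      using N by (auto simp: \<kappa>_def m_def)
    ultimately have abG: "a \<in> G 0" "b \<in> G m"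
      using I by (auto simp: G_def)
    show "\<exists>a\<in>G 0. \<forall>k\<le>m. a \<in> G k \<longrightarrow> k = 0"
    proof (intro bexI[of _ a] allI impI)
      fix k assume "a \<in> G k"
      then obtain i where i: "i \<in> {1..N}" "\<kappa> i = k" "a \<in> U i"
        using G by blast
      then have "i \<le> 2"
        using adj[OF I(1) i(1) ab(1) i(3)] by auto
      then show "k = 0"
        using i by (auto simp: \<kappa>_def)
    qed (rule abG(1))
    show "\<exists>b\<in>G m. \<forall>k\<le>m. b \<in> G k \<longrightarrow> k = m"
    proof (intro bexI[of _ b] allI impI)
      fix k assume "b \<in> G k"
      then obtain i where i: "i \<in> {1..N}" "\<kappa> i = k" "b \<in> U i"
        using G by blast
      then have "N - 1 \<le> i"
        using adj[OF I(2) i(1) ab(2) i(3)] by auto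
      then show "k = m"
        using i N by (auto simp: \<kappa>_def m_def)
    qed (rule abG(2))
  qed
  moreover have "mesh_less m G \<epsilon>"
    unfolding mesh_less_def
  proof (intro allI impI ballI)
    fix k x y assume "x \<in> G k" "y \<in> G k"
    then obtain i j where ij: "i \<in> {1..N}" "\<kappa> i = k" "x \<in> U i" "j \<in> {1..N}" "\<kappa> j = k" "y \<in> U j"
      using G[of x k] G[of y k] by blast
    have "\<kappa> i = \<kappa> j"
      using ij by simp
    then have "i \<le> Suc j" "j \<le> Suc i"
      using ij(1,4) N by (auto simp: \<kappa>_def min_def max_def split: if_splits)
    then show "dist x y < \<epsilon>"
      using near[OF ij(1,4) _ _ ij(3,6)] \<eta>(2) by linarith
  qed
  ultimately show ?thesis
    by blast
qed

subsection \<open>Homeomorphisms from chains\<close>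

lemma pseudo_arcE:
  assumes "pseudo_arc P"
  shows "compact P" "connected P" "hereditarily_indecomposable P" "chainable P"
    "\<exists>x\<in>P. \<exists>y\<in>P. x \<noteq> y"
  using assms by (simp_all add: pseudo_arc_def continuum_def)

lemma pseudo_arc_small_closed_chain:
  assumes "pseudo_arc P" "\<epsilon> > 0"
  shows "\<exists>m W. closed_chain P m W \<and> mesh_less m W \<epsilon>"
  using small_closed_chain[of P] pseudo_arcE[OF assms(1)] assms(2) by metis

lemma closed_chain_subset: "closed_chain P n V \<Longrightarrow> i \<le> n \<Longrightarrow> V i \<subseteq> P"
  by (simp add: closed_chain_def)

text \<open>Half of a back-and-forth step: chainability provides a fine refinement of
  \<open>V\<close>, and \<open>V'\<close> is lifted through its index map. Only the mesh on the
  first side is controlled.\<close>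

lemma closed_chain_refine_pair:
  assumes P: "pseudo_arc P" and V: "closed_chain P n V" "closed_chain P n V'" and \<epsilon>: "\<epsilon> > 0"
  shows "\<exists>m s W W'. closed_chain P m W \<and> closed_chain P m W' \<and> mesh_less m W \<epsilon> \<and>
    (\<forall>k\<le>m. s k \<le> n \<and> W k \<subseteq> V (s k) \<and> W' k \<subseteq> V' (s k))"
proof -
  note P' = pseudo_arcE[OF P]
  obtain \<delta> where \<delta>: "\<delta> > 0" "\<forall>S. S \<subseteq> P \<and> S \<noteq> {} \<and> (\<forall>x\<in>S. \<forall>y\<in>S. dist x y < \<delta>) \<longrightarrow> (\<exists>i\<le>n. S \<subseteq> V i)"
    by (rule mesh_less_refines[OF V(1)])
  obtain m W where W: "closed_chain P m W" "mesh_less m W (min \<delta> \<epsilon>)"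
    using pseudo_arc_small_closed_chain[OF P, of "min \<delta> \<epsilon>"] \<delta>(1) \<epsilon> by auto
  have "\<exists>i\<le>n. W k \<subseteq> V i" if k: "k \<le> m" for k
  proof -
    have "W k \<subseteq> P" "W k \<noteq> {}"
      using closed_chain_subset[OF W(1) k] closed_chain_link_nonempty[OF P'(2) W(1) k] by auto
    moreover have "\<forall>x\<in>W k. \<forall>y\<in>W k. dist x y < \<delta>"
      using W(2) k by (simp add: mesh_less_def)
    ultimately show ?thesis
      using \<delta>(2) by simp
  qed
  then obtain s where s: "\<forall>k\<le>m. s k \<le> n \<and> W k \<subseteq> V (s k)"
    by metis
  note sw = refinement_walk[OF P'(2) W(1) V(1) s]
  obtain W' where "closed_chain P m W'" "\<forall>k\<le>m. W' k \<subseteq> V' (s k)"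
    using closed_chain_lift[OF P'(1-3) V(2) sw] by blast
  moreover have "mesh_less m W \<epsilon>"
    using W(2) by (simp add: mesh_less_def)
  ultimately show ?thesis
    using W(1) s by (intro exI[of _ m] exI[of _ s] exI[of _ W] exI[of _ W']) simp
qed

text \<open>A second half step with the sides exchanged makes the other side fine. The first side
  stays fine, because its new links lie in links of \<open>W\<close>.\<close>

lemma closed_chain_refine_both:
  assumes P: "pseudo_arc P" and V: "closed_chain P n V" "closed_chain P n V'" and \<epsilon>: "\<epsilon> > 0"
  shows "\<exists>m s W W'. closed_chain P m W \<and> closed_chain P m W' \<and> mesh_less m W \<epsilon> \<and> mesh_less m W' \<epsilon> \<and>
    (\<forall>k\<le>m. s k \<le> n \<and> W k \<subseteq> V (s k) \<and> W' k \<subseteq> V' (s k))"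
proof -
  obtain m s W W' where W: "closed_chain P m W" "closed_chain P m W'" "mesh_less m W \<epsilon>"
    "\<forall>k\<le>m. s k \<le> n \<and> W k \<subseteq> V (s k) \<and> W' k \<subseteq> V' (s k)"
    using closed_chain_refine_pair[OF P V \<epsilon>] by (elim exE conjE)
  obtain l t U U' where U: "closed_chain P l U" "closed_chain P l U'" "mesh_less l U \<epsilon>"
    "\<forall>k\<le>l. t k \<le> m \<and> U k \<subseteq> W' (t k) \<and> U' k \<subseteq> W (t k)"
    using closed_chain_refine_pair[OF P W(2,1) \<epsilon>] by (elim exE conjE)
  have "mesh_less l U' \<epsilon>"
    unfolding mesh_less_def
  proof (intro allI impI ballI)
    fix k x y assume "k \<le> l" "x \<in> U' k" "y \<in> U' k"
    then have "t k \<le> m" "x \<in> W (t k)" "y \<in> W (t k)"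
      using U(4) by auto
    then show "dist x y < \<epsilon>"
      using W(3) by (simp add: mesh_less_def)
  qed
  moreover have "s (t k) \<le> n \<and> U' k \<subseteq> V (s (t k)) \<and> U k \<subseteq> V' (s (t k))" if k: "k \<le> l" for k
  proof -
    have tk: "t k \<le> m" "U k \<subseteq> W' (t k)" "U' k \<subseteq> W (t k)"
      using U(4) k by auto
    then show ?thesis
      using W(4)[rule_format, OF tk(1)] by auto
  qed
  ultimately show ?thesis
    using U by (intro exI[of _ l] exI[of _ "\<lambda>k. s (t k)"] exI[of _ U'] exI[of _ U]) simp
qed

lemma mesh_less_adjacent:
  assumes P: "connected P" and V: "closed_chain P n V" "mesh_less n V \<epsilon>"
    and ij: "i \<le> n" "j \<le> n" "i \<le> Suc j" "j \<le> Suc i" and xy: "x \<in> V i" "y \<in> V j"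
  shows "dist x y < 2 * \<epsilon>"
proof -
  have "V i \<inter> V j \<noteq> {}"
  proof -
    consider "i = j" | "j = Suc i" | "i = Suc j"
      using ij by linarith
    then show ?thesis
    proof cases
      case 1
      then show ?thesis using xy by auto
    next
      case 2
      then show ?thesis using closed_chain_link_Int[OF P V(1), of i] ij by auto
    next
      case 3
      then show ?thesis using closed_chain_link_Int[OF P V(1), of j] ij by auto
    qed
  qed
  then obtain z where "z \<in> V i" "z \<in> V j"
    by blast
  then have "dist x z < \<epsilon>" "dist z y < \<epsilon>"
    using V(2) ij xy by (auto simp: mesh_less_def)
  then show ?thesis
    using dist_triangle[of x y z] by linarith
qed

lemma nested_closed_Inter_nonempty:
  fixes F :: "nat \<Rightarrow> 'a::topological_space set"
  assumes "compact S" and F: "\<And>t. closed (F t)" "\<And>t. F t \<noteq> {}" "\<And>t. F t \<subseteq> S" "\<And>t. F (Suc t) \<subseteq> F t"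
  shows "\<exists>x\<in>S. \<forall>t. x \<in> F t"
proof -
  have dec: "F t \<subseteq> F u" if "u \<le> t" for t u
    using that lift_Suc_antimono_le[of F] F(4) by blast
  have "S \<inter> (\<Inter>t\<in>UNIV. F t) \<noteq> {}"
  proof (rule compact_imp_fip_image[OF assms(1)])
    fix I :: "nat set" assume I: "finite I"
    obtain x where x: "x \<in> F (Max (insert 0 I))"
      using F(2) by blast
    have "x \<in> F t" if "t \<in> I" for t
      using dec[of t "Max (insert 0 I)"] x I that by auto
    then show "S \<inter> (\<Inter>t\<in>I. F t) \<noteq> {}"
      using x F(3) by blast
  qed (use F in auto)
  then show ?thesis
    by blast
qed

text \<open>Two sequences of chains refining each other along the same index maps identify the points with
  the same itineraries.\<close>

lemma closed_chain_tower_fibre: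
  assumes P: "compact P" and Pc: "connected P" and V: "\<And>t. closed_chain P (N t) (V t)" "\<And>t. closed_chain P (N t) (V' t)"
    and s: "\<And>t k. k \<le> N (Suc t) \<Longrightarrow> s t k \<le> N t \<and> V (Suc t) k \<subseteq> V t (s t k) \<and> V' (Suc t) k \<subseteq> V' t (s t k)"
    and x: "x \<in> P"
  shows "\<exists>y\<in>P. \<forall>t. \<exists>k\<le>N t. x \<in> V t k \<and> y \<in> V' t k"
proof -
  \<comment> \<open>Taking all links that correspond to links through \<open>x\<close>, instead of
    choosing one at each stage, makes these sets nested without any coherent choice of
    indices.\<close>
  define F where "F t = (\<Union>k\<in>{k. k \<le> N t \<and> x \<in> V t k}. V' t k)" for t
  have "\<exists>y\<in>P. \<forall>t. y \<in> F t"
  proof (rule nested_closed_Inter_nonempty[OF P])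
    fix t
    have cl: "\<forall>k\<le>N t. closed (V' t k) \<and> V' t k \<subseteq> P"
      using V(2)[of t] by (simp add: closed_chain_def)
    show "closed (F t)"
      unfolding F_def by (rule closed_UN) (use cl in auto)
    show "F t \<subseteq> P"
      unfolding F_def using cl by auto
    obtain k where k: "k \<le> N t" "x \<in> V t k"
      by (rule closed_chain_cover[OF V(1) x])
    have "V' t k \<noteq> {}"
      by (rule closed_chain_link_nonempty[OF Pc V(2) k(1)])
    then show "F t \<noteq> {}"
      using k unfolding F_def by blast
    show "F (Suc t) \<subseteq> F t"
    proof
      fix y assume "y \<in> F (Suc t)"
      then obtain k where k: "k \<le> N (Suc t)" "x \<in> V (Suc t) k" "y \<in> V' (Suc t) k"
        by (auto simp: F_def)
      then have "s t k \<le> N t" "x \<in> V t (s t k)" "y \<in> V' t (s t k)"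
        using s[OF k(1)] by auto
      then show "y \<in> F t"
        by (auto simp: F_def)
    qed
  qed
  then show ?thesis
    by (auto simp: F_def)
qed

text \<open>Both partners lie in links that equal or neighbour link \<open>k\<close> of the second
  chain. This one estimate gives continuity of the correspondence, and uniqueness of partners when
  \<open>x = x'\<close>.\<close>

lemma closed_chain_tower_close:
  assumes P: "connected P" and V: "closed_chain P n V" "closed_chain P n V'" "mesh_less n V' \<epsilon>"
    and k: "k \<le> n" "x \<in> V k" "x' \<in> V k"
    and xy: "\<exists>i\<le>n. x \<in> V i \<and> y \<in> V' i" "\<exists>i\<le>n. x' \<in> V i \<and> y' \<in> V' i"
  shows "dist y y' < 4 * \<epsilon>"
proof -
  obtain i i' where i: "i \<le> n" "x \<in> V i" "y \<in> V' i" "i' \<le> n" "x' \<in> V i'" "y' \<in> V' i'"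
    using xy by blast
  obtain z where z: "z \<in> V' k"
    using closed_chain_link_nonempty[OF P V(2) k(1)] by blast
  have "dist y z < 2 * \<epsilon>"
    by (rule mesh_less_adjacent[OF P V(2,3) i(1) k(1) _ _ i(3) z])
      (use closed_chain_adjacent[OF V(1) i(1) k(1) i(2) k(2)] in auto)
  moreover have "dist y' z < 2 * \<epsilon>"
    by (rule mesh_less_adjacent[OF P V(2,3) i(4) k(1) _ _ i(6) z])
      (use closed_chain_adjacent[OF V(1) i(4) k(1) i(5) k(3)] in auto)
  ultimately show ?thesis
    using dist_triangle2[of y y' z] by linarith
qed

text \<open>Iterated refinement gives a tower whose meshes tend to zero on both sides. Each point of
  \<open>P\<close> has exactly one partner with a common itinerary, in either direction, and the
  stage \<open>0\<close> of the tower gives the link-by-link statement.\<close>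

lemma closed_chain_homeomorphism:
  fixes P :: "'a::metric_space set"
  assumes P: "pseudo_arc P" and V0: "closed_chain P n V0" "closed_chain P n V0'"
  shows "\<exists>g g'. homeomorphism P P g g' \<and> (\<forall>x\<in>P. \<exists>k\<le>n. x \<in> V0 k \<and> g x \<in> V0' k)"
proof -
  note P' = pseudo_arcE[OF P]
  \<comment> \<open>Stage \<open>0\<close> is pinned to the given pair of chains, on whose meshes
    nothing is known; hence the guard \<open>0 < t\<close>.\<close>
  define good where "good t z \<longleftrightarrow> (case z of (m, V, V') \<Rightarrow> closed_chain P m V \<and> closed_chain P m V' \<and>
      (0 < t \<longrightarrow> mesh_less m V (1 / real t) \<and> mesh_less m V' (1 / real t)) \<and> (t = 0 \<longrightarrow> z = (n, V0, V0')))"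
    for t and z :: "nat \<times> (nat \<Rightarrow> 'a set) \<times> (nat \<Rightarrow> 'a set)"
  define refines where "refines z w \<longleftrightarrow> (case z of (m, V, V') \<Rightarrow> case w of (l, W, W') \<Rightarrow>
      (\<forall>k\<le>l. \<exists>i\<le>m. W k \<subseteq> V i \<and> W' k \<subseteq> V' i))"
    for z w :: "nat \<times> (nat \<Rightarrow> 'a set) \<times> (nat \<Rightarrow> 'a set)"
  have "\<exists>f. \<forall>t. good t (f t) \<and> refines (f t) (f (Suc t))"
  proof (rule dependent_nat_choice)
    show "\<exists>z. good 0 z"
      using V0 by (intro exI[of _ "(n, V0, V0')"]) (simp add: good_def)
    fix z t assume z: "good t z"
    obtain m V V' where zz: "z = (m, V, V')"
      by (cases z) auto
    then have V: "closed_chain P m V" "closed_chain P m V'"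
      using z by (simp_all add: good_def)
    obtain l s W W' where W: "closed_chain P l W" "closed_chain P l W'"
      "mesh_less l W (1 / real (Suc t))" "mesh_less l W' (1 / real (Suc t))"
      "\<forall>k\<le>l. s k \<le> m \<and> W k \<subseteq> V (s k) \<and> W' k \<subseteq> V' (s k)"
      using closed_chain_refine_both[OF P V, of "1 / real (Suc t)"] by (auto simp del: of_nat_Suc)
    have "good (Suc t) (l, W, W')"
      using W by (simp add: good_def)
    moreover have "refines z (l, W, W')"
      using W(5) by (auto simp: refines_def zz)
    ultimately show "\<exists>w. good (Suc t) w \<and> refines z w"
      by blast
  qed
  then obtain f where f: "\<And>t. good t (f t)" "\<And>t. refines (f t) (f (Suc t))"
    by blast
  define N where "N t = fst (f t)" for t
  define V where "V t = fst (snd (f t))" for t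
  define V' where "V' t = snd (snd (f t))" for t
  have ft: "f t = (N t, V t, V' t)" for t
    by (simp add: N_def V_def V'_def)
  have V: "closed_chain P (N t) (V t)" "closed_chain P (N t) (V' t)" for t
    using f(1)[of t] by (simp_all add: good_def ft)
  have mesh: "mesh_less (N t) (V t) (1 / real t)" "mesh_less (N t) (V' t) (1 / real t)" if "0 < t" for t
    using f(1)[of t] that by (simp_all add: good_def ft)
  have start: "N 0 = n" "V 0 = V0" "V' 0 = V0'"
    using f(1)[of 0] by (simp_all add: good_def ft)
  have "\<forall>t. \<forall>k\<in>{..N (Suc t)}. \<exists>i. i \<le> N t \<and> V (Suc t) k \<subseteq> V t i \<and> V' (Suc t) k \<subseteq> V' t i"
    using f(2) by (fastforce simp: refines_def ft)
  then obtain s where s: "\<forall>t. \<forall>k\<in>{..N (Suc t)}. s t k \<le> N t \<and> V (Suc t) k \<subseteq> V t (s t k) \<and> V' (Suc t) k \<subseteq> V' t (s t k)"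
    by metis
  have "\<forall>x\<in>P. \<exists>y. y \<in> P \<and> (\<forall>t. \<exists>k\<le>N t. x \<in> V t k \<and> y \<in> V' t k)"
    using closed_chain_tower_fibre[OF P'(1,2), of N V V' s, OF V] s by blast
  then obtain g where g: "\<forall>x\<in>P. g x \<in> P \<and> (\<forall>t. \<exists>k\<le>N t. x \<in> V t k \<and> g x \<in> V' t k)"
    by metis
  have small: "\<exists>t>0. 4 * (1 / real t) < e" if "e > 0" for e :: real
  proof -
    obtain t where "4 / e < real t"
      using reals_Archimedean2 by blast
    moreover have "0 < 4 / e"
      using that by simp
    ultimately have "0 < t" "4 < e * real t"
      using that by (auto simp: field_simps intro: gr0I)
    then show ?thesis
      using that by (intro exI[of _ t]) (auto simp: field_simps)
  qed
  have cont: "continuous_on P g"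
    unfolding continuous_on_iff
  proof (intro ballI allI impI)
    fix x e assume x: "x \<in> P" and e: "(0::real) < e"
    obtain t where t: "0 < t" "4 * (1 / real t) < e"
      using small[OF e] by blast
    obtain \<delta> where \<delta>: "\<delta> > 0" "\<forall>x\<in>P. \<exists>i\<le>N t. P \<inter> ball x \<delta> \<subseteq> V t i"
      by (rule closed_chain_lebesgue[OF V(1)])
    obtain k where k: "k \<le> N t" "P \<inter> ball x \<delta> \<subseteq> V t k"
      using \<delta>(2) x by blast
    show "\<exists>d>0. \<forall>x'\<in>P. dist x' x < d \<longrightarrow> dist (g x') (g x) < e"
    proof (intro exI[of _ \<delta>] conjI ballI impI)
      fix x' assume x': "x' \<in> P" "dist x' x < \<delta>"
      then have "x' \<in> V t k" "x \<in> V t k"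
        using k x \<delta>(1) by (auto simp: dist_commute)
      then have "dist (g x') (g x) < 4 * (1 / real t)"
        using closed_chain_tower_close[OF P'(2) V(1) V(2) mesh(2)[OF t(1)] k(1)] g x x' by blast
      then show "dist (g x') (g x) < e"
        using t(2) by linarith
    qed (rule \<delta>(1))
  qed
  \<comment> \<open>Injectivity uses the closeness estimate with the two towers exchanged.
    Surjectivity below takes a partner \<open>x\<close> of \<open>y\<close> from the exchanged
    towers and then shows that \<open>g x\<close> and \<open>y\<close>, both partners of
    \<open>x\<close>, coincide.\<close>
  have inj: "inj_on g P"
  proof (rule inj_onI, rule ccontr)
    fix x x' assume x: "x \<in> P" "x' \<in> P" "g x = g x'" "x \<noteq> x'"
    obtain t where t: "0 < t" "4 * (1 / real t) < dist x x'"
      using small[of "dist x x'"] x by auto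
    obtain k where k: "k \<le> N t" "g x \<in> V' t k"
      using closed_chain_cover[OF V(2)[of t], of "g x"] g x by blast
    have "dist x x' < 4 * (1 / real t)"
      using closed_chain_tower_close[OF P'(2) V(2) V(1) mesh(1)[OF t(1)] k(1), of "g x" "g x" x x'] k(2) g x by metis
    then show False
      using t(2) by linarith
  qed
  have surj: "g ` P = P"
  proof
    show "P \<subseteq> g ` P"
    proof
      fix y assume y: "y \<in> P"
      obtain x where x: "x \<in> P" "\<forall>t. \<exists>k\<le>N t. y \<in> V' t k \<and> x \<in> V t k"
        using closed_chain_tower_fibre[OF P'(1,2), of N V' V s, OF V(2,1) _ y] s by blast
      have "y = g x"
      proof (rule ccontr)
        assume "y \<noteq> g x"
        then obtain t where t: "0 < t" "4 * (1 / real t) < dist y (g x)"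
          using small[of "dist y (g x)"] by auto
        obtain k where k: "k \<le> N t" "x \<in> V t k"
          using closed_chain_cover[OF V(1)[of t] x(1)] by blast
        have "dist y (g x) < 4 * (1 / real t)"
          using closed_chain_tower_close[OF P'(2) V(1) V(2) mesh(2)[OF t(1)] k(1), of x x y "g x"] k(2) g x by metis
        then show False
          using t(2) by linarith
      qed
      then show "y \<in> g ` P"
        using x by blast
    qed
  qed (use g in blast)
  obtain g' where "homeomorphism P P g g'"
    using homeomorphism_compact[OF P'(1) cont surj inj] by blast
  moreover have "\<forall>x\<in>P. \<exists>k\<le>n. x \<in> V0 k \<and> g x \<in> V0' k"
    using g start by metis
  ultimately show ?thesis
    by blast
qed

subsection \<open>Density of the conjugates\<close>

text \<open>A pointwise form in which only values on \<open>P\<close> matter. Such a map is its own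
  inverse on \<open>P\<close>, so continuity makes it a homeomorphism.\<close>

definition involution_on :: "'a::metric_space set \<Rightarrow> ('a \<Rightarrow> 'a) \<Rightarrow> bool" where
  "involution_on P f \<longleftrightarrow> continuous_on P f \<and> (\<forall>x\<in>P. f x \<in> P \<and> f (f x) = x)"

lemma involution_onD:
  assumes "involution_on P f"
  shows "continuous_on P f" "x \<in> P \<Longrightarrow> f x \<in> P" "x \<in> P \<Longrightarrow> f (f x) = x"
  using assms by (simp_all add: involution_on_def)

lemma compact_uniform_modulus:
  fixes f :: "'a::metric_space \<Rightarrow> 'b::metric_space"
  assumes "compact P" "continuous_on P f" "\<epsilon> > 0"
  obtains \<delta> where "\<delta> > 0" "\<forall>x\<in>P. \<forall>y\<in>P. dist x y < \<delta> \<longrightarrow> dist (f x) (f y) < \<epsilon>"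
  using compact_uniformly_continuous[OF assms(2,1)] assms(3)
  unfolding uniformly_continuous_on_def by (metis dist_commute)

text \<open>The chain is pulled back from overlapping intervals along a map \<open>\<tau>\<close>
  that turns \<open>F\<close> into the flip of \<open>[0, N + 1]\<close>. Any length
  \<open>N\<close> is available, since the interval may be divided at will.\<close>

lemma symmetric_closed_chain:
  fixes P :: "'a::metric_space set"
  assumes P: "compact P" and F: "involution_on P F" and x0: "x0 \<in> P" "F x0 \<noteq> x0" and N: "0 < N"
  shows "\<exists>E. closed_chain P N E \<and> (\<forall>j\<le>N. \<forall>x\<in>E j. F x \<in> E (N - j))"
proof -
  note F' = involution_onD[OF F]
  \<comment> \<open>This is the odd function of the overview, built from the distance to
    \<open>x0\<close>; it does not vanish at \<open>x0\<close>, so its maximum is positive.\<close>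
  define \<phi> where "\<phi> x = dist x x0 - dist (F x) x0" for x
  have odd: "\<phi> (F x) = - \<phi> x" if "x \<in> P" for x
    using F' that by (simp add: \<phi>_def)
  have c\<phi>: "continuous_on P \<phi>"
    unfolding \<phi>_def by (intro continuous_intros F')
  obtain xm where xm: "xm \<in> P" "\<forall>x\<in>P. \<phi> x \<le> \<phi> xm"
    using continuous_attains_sup[OF P _ c\<phi>] x0(1) by blast
  define a where "a = \<phi> xm"
  have "\<phi> (F x0) = dist (F x0) x0"
    using x0 odd by (simp add: \<phi>_def)
  then have "dist (F x0) x0 \<le> a"
    using xm(2) F'(2)[OF x0(1)] unfolding a_def by metis
  moreover have "0 < dist (F x0) x0"
    using x0(2) by simp
  ultimately have a: "0 < a"
    by linarith
  have range: "- a \<le> \<phi> x \<and> \<phi> x \<le> a" if "x \<in> P" for x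
  proof -
    have "\<phi> x \<le> a" "\<phi> (F x) \<le> a"
      using xm(2) F'(2) that unfolding a_def by blast+
    then show ?thesis
      using odd[OF that] by linarith
  qed
  define \<tau> where "\<tau> x = (\<phi> x + a) * (real N + 1) / (2 * a)" for x
  have c\<tau>: "continuous_on P \<tau>"
    unfolding \<tau>_def using a by (intro continuous_intros c\<phi>) auto
  have \<tau>F: "\<tau> (F x) = real N + 1 - \<tau> x" if "x \<in> P" for x
    using odd[OF that] a by (simp add: \<tau>_def field_simps)
  have \<tau>ends: "\<tau> xm = real N + 1" "\<tau> (F xm) = 0"
    using odd[OF xm(1)] a by (simp_all add: \<tau>_def a_def[symmetric] field_simps)
  have \<tau>r: "0 \<le> \<tau> x \<and> \<tau> x \<le> real N + 1" if "x \<in> P" for x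
  proof -
    have "0 \<le> (\<phi> x + a) * (real N + 1)" "(\<phi> x + a) * (real N + 1) \<le> (2 * a) * (real N + 1)"
      using range[OF that] by (auto intro!: mult_nonneg_nonneg mult_right_mono)
    then show ?thesis
      using a by (simp add: \<tau>_def field_simps)
  qed
  \<comment> \<open>Unit intervals enlarged by \<open>1/4\<close>: neighbours overlap, intervals two
    steps apart stay disjoint, and the flip \<open>N + 1 - \<tau>\<close> takes the interval for
    \<open>j\<close> exactly to the one for \<open>N - j\<close>.\<close>
  define E where "E j = P \<inter> \<tau> -` {real j - 1/4 .. real j + 5/4}" for j
  have EI: "x \<in> E j \<longleftrightarrow> x \<in> P \<and> real j - 1/4 \<le> \<tau> x \<and> \<tau> x \<le> real j + 5/4" for x j
    by (auto simp: E_def)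
  have "closed_chain P N E"
    unfolding closed_chain_def
  proof (intro conjI allI impI)
    show "closed (E j)" for j
      unfolding E_def by (intro continuous_closed_preimage c\<tau> compact_imp_closed P closed_atLeastAtMost)
    show "E j \<subseteq> P" for j
      by (auto simp: E_def)
    obtain \<delta> where \<delta>: "\<delta> > 0" "\<forall>x\<in>P. \<forall>y\<in>P. dist x y < \<delta> \<longrightarrow> dist (\<tau> x) (\<tau> y) < 1/4"
      by (rule compact_uniform_modulus[OF P c\<tau>, of "1/4"]) auto
    show "\<exists>\<delta>>0. \<forall>x\<in>P. \<exists>i\<le>N. P \<inter> ball x \<delta> \<subseteq> E i"
    proof (intro exI[of _ \<delta>] conjI ballI)
      fix x assume x: "x \<in> P"
      \<comment> \<open>The minimum with \<open>N\<close> places the extreme value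
        \<open>N + 1\<close> in the last link.\<close>
      define j where "j = min N (nat \<lfloor>\<tau> x\<rfloor>)"
      have j: "j \<le> N" "real j \<le> \<tau> x" "\<tau> x \<le> real j + 1"
        using \<tau>r[OF x] unfolding j_def by (auto simp: min_def) linarith+
      have "P \<inter> ball x \<delta> \<subseteq> E j"
      proof
        fix y assume y: "y \<in> P \<inter> ball x \<delta>"
        then have "\<bar>\<tau> x - \<tau> y\<bar> < 1/4"
          using \<delta>(2) x by (simp add: dist_real_def)
        moreover have "y \<in> P"
          using y by simp
        ultimately show "y \<in> E j"
          using j unfolding EI by linarith
      qed
      then show "\<exists>i\<le>N. P \<inter> ball x \<delta> \<subseteq> E i"
        using j(1) by blast
    qed (rule \<delta>(1))
    show "E i \<inter> E j = {}" if "Suc i < j" for i j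
    proof (rule equals0I)
      fix x assume "x \<in> E i \<inter> E j"
      then have "real j - 1/4 \<le> real i + 5/4"
        by (auto simp: EI)
      moreover have "real i + 2 \<le> real j"
        using that by linarith
      ultimately show False
        by linarith
    qed
    show "\<exists>a\<in>E 0. \<forall>i\<le>N. a \<in> E i \<longrightarrow> i = 0"
      using F'(2)[OF xm(1)] \<tau>ends by (intro bexI[of _ "F xm"]) (auto simp: EI)
    show "\<exists>b\<in>E N. \<forall>i\<le>N. b \<in> E i \<longrightarrow> i = N"
      using xm(1) \<tau>ends by (intro bexI[of _ xm]) (auto simp: EI)
  qed (rule N)
  moreover have "F x \<in> E (N - j)" if "j \<le> N" "x \<in> E j" for j x
    using that \<tau>F[of x] F'(2)[of x] by (auto simp: EI of_nat_diff)
  ultimately show ?thesis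
    by blast
qed

text \<open>The preimages are used so that one fine chain can refine both \<open>C\<close> and its
  pullback under \<open>f\<close>; its two index maps then record a link and the image of that link.
  Private points \<open>a\<close>, \<open>b\<close> pull back to \<open>f a\<close>,
  \<open>f b\<close>.\<close>

lemma closed_chain_vimage:
  assumes P: "compact P" and f: "involution_on P f" and V: "closed_chain P n V"
  shows "closed_chain P n (\<lambda>i. P \<inter> f -` V i)"
proof -
  note f' = involution_onD[OF f]
  have V': "0 < n" "\<forall>i\<le>n. closed (V i) \<and> V i \<subseteq> P" "\<forall>i\<le>n. \<forall>j\<le>n. Suc i < j \<longrightarrow> V i \<inter> V j = {}"
    using V by (simp_all add: closed_chain_def)
  show ?thesis
    unfolding closed_chain_def
  proof (intro conjI allI impI)
    show "closed (P \<inter> f -` V i)" if "i \<le> n" for i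
      using continuous_closed_preimage[OF f'(1) compact_imp_closed[OF P]] V'(2) that by simp
    show "(P \<inter> f -` V i) \<inter> (P \<inter> f -` V j) = {}" if "i \<le> n" "j \<le> n" "Suc i < j" for i j
    proof -
      have "V i \<inter> V j = {}"
        using V'(3) that by simp
      then show ?thesis
        by blast
    qed
    obtain \<delta> where \<delta>: "\<delta> > 0" "\<forall>x\<in>P. \<exists>i\<le>n. P \<inter> ball x \<delta> \<subseteq> V i"
      by (rule closed_chain_lebesgue[OF V])
    obtain \<eta> where \<eta>: "\<eta> > 0" "\<forall>x\<in>P. \<forall>y\<in>P. dist x y < \<eta> \<longrightarrow> dist (f x) (f y) < \<delta>"
      by (rule compact_uniform_modulus[OF P f'(1) \<delta>(1)])
    show "\<exists>\<delta>>0. \<forall>x\<in>P. \<exists>i\<le>n. P \<inter> ball x \<delta> \<subseteq> P \<inter> f -` V i"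
    proof (intro exI[of _ \<eta>] conjI ballI)
      fix x assume x: "x \<in> P"
      then obtain i where i: "i \<le> n" "P \<inter> ball (f x) \<delta> \<subseteq> V i"
        using \<delta>(2) f'(2) by blast
      have "P \<inter> ball x \<eta> \<subseteq> P \<inter> f -` V i"
      proof
        fix y assume y: "y \<in> P \<inter> ball x \<eta>"
        then have "f y \<in> P \<inter> ball (f x) \<delta>"
          using \<eta>(2) x f'(2) by simp
        then show "y \<in> P \<inter> f -` V i"
          using i(2) y by auto
      qed
      then show "\<exists>i\<le>n. P \<inter> ball x \<eta> \<subseteq> P \<inter> f -` V i"
        using i(1) by blast
    qed (rule \<eta>(1))
    obtain a b where a: "a \<in> V 0" "\<forall>i\<le>n. a \<in> V i \<longrightarrow> i = 0" and b: "b \<in> V n" "\<forall>i\<le>n. b \<in> V i \<longrightarrow> i = n"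
      by (rule closed_chain_ends[OF V])
    have ab: "a \<in> P" "b \<in> P"
      using a(1) b(1) V'(2) by auto
    show "\<exists>a\<in>P \<inter> f -` V 0. \<forall>i\<le>n. a \<in> P \<inter> f -` V i \<longrightarrow> i = 0"
      using a ab(1) f' by (intro bexI[of _ "f a"]) simp_all
    show "\<exists>b\<in>P \<inter> f -` V n. \<forall>i\<le>n. b \<in> P \<inter> f -` V i \<longrightarrow> i = n"
      using b ab(2) f' by (intro bexI[of _ "f b"]) simp_all
  qed (use V' in auto)
qed

text \<open>The combinatorial form of the fixed point property of chainable continua.\<close>

lemma walks_cross:
  assumes p: "walk m n p" and q: "walk m n q" and onto: "\<forall>i\<le>n. \<exists>k\<le>m. p k = i"
  shows "\<exists>c\<le>m. p c \<le> Suc (q c) \<and> q c \<le> Suc (p c)"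
proof (rule ccontr)
  assume no: "\<not> ?thesis"
  have far: "Suc (q k) < p k \<or> Suc (p k) < q k" if "k \<le> m" for k
  proof -
    have "\<not> (p k \<le> Suc (q k) \<and> q k \<le> Suc (p k))"
      using no that by blast
    then show ?thesis
      by linarith
  qed
  \<comment> \<open>With a gap of at least two and steps of at most one on each side, the walks can
    never exchange their order. It is opposite at the places where \<open>p\<close> takes the values
    \<open>n\<close> and \<open>0\<close>.\<close>
  have const: "k \<le> m \<Longrightarrow> q k < p k \<longleftrightarrow> q 0 < p 0" for k
  proof (induction k)
    case (Suc k)
    then have "q k < p k \<longleftrightarrow> q 0 < p 0"
      by simp
    moreover have "q (Suc k) < p (Suc k) \<longleftrightarrow> q k < p k"
      using far[of k] far[of "Suc k"] walk_step[OF p, of k] walk_step[OF q, of k] Suc.prems by linarith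
    ultimately show ?case
      by simp
  qed simp
  obtain k where k: "k \<le> m" "p k = n"
    using onto[rule_format, of n] by auto
  obtain l where l: "l \<le> m" "p l = 0"
    using onto[rule_format, of 0] by auto
  have "q k \<le> n"
    using walk_bound[OF q k(1)] .
  then have "q k < p k"
    using far[OF k(1)] k by linarith
  moreover have "\<not> q l < p l"
    using l by simp
  ultimately show False
    using const[OF k(1)] const[OF l(1)] by simp
qed

text \<open>Up to the mesh, an involution is a quotient of the flip of an arc: starting at a link that is
  almost fixed, follow a walk through all links in one direction and its image in the other.\<close>

lemma involution_folding:
  assumes P: "pseudo_arc P" and f: "involution_on P f" and C: "closed_chain P n C"
  shows "\<exists>N u. 0 < N \<and> walk N n u \<and> (\<forall>i\<le>n. \<exists>j\<le>N. u j = i) \<and> (\<forall>j\<le>N. \<exists>z\<in>C (u j). f z \<in> C (u (N - j)))"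
proof -
  note P' = pseudo_arcE[OF P] and f' = involution_onD[OF f]
  note fC = closed_chain_vimage[OF P'(1) f C]
  obtain \<delta> where \<delta>: "\<delta> > 0" "\<forall>S. S \<subseteq> P \<and> S \<noteq> {} \<and> (\<forall>x\<in>S. \<forall>y\<in>S. dist x y < \<delta>) \<longrightarrow> (\<exists>i\<le>n. S \<subseteq> C i)"
    by (rule mesh_less_refines[OF C])
  obtain \<delta>' where \<delta>': "\<delta>' > 0"
    "\<forall>S. S \<subseteq> P \<and> S \<noteq> {} \<and> (\<forall>x\<in>S. \<forall>y\<in>S. dist x y < \<delta>') \<longrightarrow> (\<exists>i\<le>n. S \<subseteq> P \<inter> f -` C i)"
    by (rule mesh_less_refines[OF fC])
  obtain m D where D: "closed_chain P m D" "mesh_less m D (min \<delta> \<delta>')"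
    using pseudo_arc_small_closed_chain[OF P, of "min \<delta> \<delta>'"] \<delta>(1) \<delta>'(1) by auto
  have D': "D k \<subseteq> P \<and> D k \<noteq> {} \<and> (\<forall>x\<in>D k. \<forall>y\<in>D k. dist x y < \<delta> \<and> dist x y < \<delta>')" if "k \<le> m" for k
    using closed_chain_subset[OF D(1) that] closed_chain_link_nonempty[OF P'(2) D(1) that] D(2) that
    by (simp add: mesh_less_def)
  have "\<exists>i\<le>n. D k \<subseteq> C i" "\<exists>i\<le>n. D k \<subseteq> P \<inter> f -` C i" if "k \<le> m" for k
    using D'[OF that] by (intro \<delta>(2)[rule_format] \<delta>'(2)[rule_format]; simp)+
  then have "\<forall>k\<in>{..m}. \<exists>i. i \<le> n \<and> D k \<subseteq> C i" "\<forall>k\<in>{..m}. \<exists>i. i \<le> n \<and> D k \<subseteq> P \<inter> f -` C i"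
    by auto
  then obtain p q where pq: "\<forall>k\<in>{..m}. p k \<le> n \<and> D k \<subseteq> C (p k)" "\<forall>k\<in>{..m}. q k \<le> n \<and> D k \<subseteq> P \<inter> f -` C (q k)"
    by metis
  have p: "walk m n p" "\<forall>i\<le>n. \<exists>k\<le>m. p k = i"
    using refinement_walk[OF P'(2) D(1) C, of p] pq(1) by simp_all
  have q: "walk m n q"
    using refinement_walk(1)[OF P'(2) D(1) fC, of q] pq(2) by simp
  obtain c where c: "c \<le> m" "p c \<le> Suc (q c)" "q c \<le> Suc (p c)"
    using walks_cross[OF p(1) q p(2)] by blast
  \<comment> \<open>From the almost fixed link \<open>c\<close> the walk goes down to
    \<open>0\<close> and then up to \<open>m\<close>, so it visits every link.\<close>
  define \<kappa> where "\<kappa> t = (if t \<le> c then c - t else t - c)" for t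
  define T where "T = c + m"
  have \<kappa>: "walk T m \<kappa>"
    unfolding walk_def using c(1) by (auto simp: \<kappa>_def T_def)
  have qk: "walk T n (\<lambda>t. q (\<kappa> t))" and pk: "walk T n (\<lambda>t. p (\<kappa> t))"
    by (rule walk_comp[OF \<kappa> q], rule walk_comp[OF \<kappa> p(1)])
  \<comment> \<open>The length is odd because \<open>p c\<close> and \<open>q c\<close> are only
    known to be adjacent or equal: positions \<open>T\<close> and \<open>T + 1\<close> hold
    \<open>q c\<close> and \<open>p c\<close>. The flip exchanges \<open>T - t\<close>, which
    carries \<open>q (\<kappa> t)\<close>, with \<open>T + 1 + t\<close>, which carries
    \<open>p (\<kappa> t)\<close>.\<close>
  define N where "N = 2 * T + 1"
  define u where "u j = (if j \<le> T then q (\<kappa> (T - j)) else p (\<kappa> (j - T - 1)))" for j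
  have "walk N n u"
    unfolding walk_def
  proof (intro conjI allI impI)
    show "u j \<le> n" if "j \<le> N" for j
      using that walk_bound[OF qk] walk_bound[OF pk] by (auto simp: u_def N_def)
    fix j assume j: "j < N"
    consider "j < T" | "j = T" | "T < j"
      by linarith
    then have "u (Suc j) \<le> Suc (u j) \<and> u j \<le> Suc (u (Suc j))"
    proof cases
      case 1
      then have "Suc (T - Suc j) = T - j" "T - Suc j < T"
        by auto
      then show ?thesis
        using 1 walk_step[OF qk, of "T - Suc j"] by (auto simp: u_def)
    next
      case 2
      then show ?thesis
        using c by (simp add: u_def \<kappa>_def)
    next
      case 3
      then have "Suc (j - T - 1) = Suc j - T - 1" "j - T - 1 < T"
        using j by (auto simp: N_def)
      then show ?thesis
        using 3 walk_step[OF pk, of "j - T - 1"] by (auto simp: u_def)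
    qed
    then show "u (Suc j) \<le> Suc (u j)" "u j \<le> Suc (u (Suc j))"
      by auto
  qed
  moreover have "\<exists>j\<le>N. u j = i" if i: "i \<le> n" for i
  proof -
    obtain k where k: "k \<le> m" "p k = i"
      using p(2)[rule_format, OF i] by auto
    have "u (T + 1 + (c + k)) = i" "T + 1 + (c + k) \<le> N"
      using k by (auto simp: u_def \<kappa>_def N_def T_def)
    then show ?thesis
      by blast
  qed
  moreover have "\<exists>z\<in>C (u j). f z \<in> C (u (N - j))" if j: "j \<le> N" for j
  proof (cases "j \<le> T")
    case True
    define i where "i = \<kappa> (T - j)"
    have i: "i \<le> m"
      unfolding i_def using walk_bound[OF \<kappa>] by simp
    then obtain e where e: "e \<in> D i"
      using D' by blast
    then have "e \<in> P" "e \<in> C (p i)" "f e \<in> C (q i)"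
      using pq i by auto
    moreover have "u j = q i" "u (N - j) = p i"
      using True by (auto simp: u_def i_def N_def)
    \<comment> \<open>A point \<open>e\<close> of the fine link runs from \<open>C (p i)\<close> to
      \<open>C (q i)\<close> under \<open>f\<close>. On the \<open>q\<close> half the roles are
      reversed, so \<open>f e\<close> is the witness, with \<open>f (f e) = e\<close>.\<close>
    ultimately show ?thesis
      using f'(3) by (intro bexI[of _ "f e"]) auto
  next
    case False
    define i where "i = \<kappa> (j - T - 1)"
    have i: "i \<le> m"
      unfolding i_def using False j by (intro walk_bound[OF \<kappa>]) (simp add: N_def)
    then obtain e where e: "e \<in> D i"
      using D' by blast
    then have "e \<in> C (p i)" "f e \<in> C (q i)"
      using pq i by auto
    moreover have "T - (N - j) = j - T - 1" "N - j \<le> T"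
      using False j by (auto simp: N_def)
    then have "u j = p i" "u (N - j) = q i"
      using False by (auto simp: u_def i_def)
    ultimately show ?thesis
      by (intro bexI[of _ e]) auto
  qed
  moreover have "0 < N"
    by (simp add: N_def)
  ultimately show ?thesis
    by blast
qed

text \<open>Lifting \<open>C\<close> through the folding walk \<open>u\<close> gives a chain
  \<open>C'\<close> of length \<open>N\<close>, and \<open>g\<close> carries the symmetric chain
  \<open>E\<close> of \<open>F\<close> to it. The conjugate then moves link \<open>j\<close> of
  \<open>C'\<close> to about link \<open>N - j\<close>, and the images of these links under
  \<open>u\<close> are related by \<open>f\<close> up to the mesh of \<open>C\<close>.\<close>

lemma conjugates_dense:
  fixes P :: "'a::metric_space set"
  assumes P: "pseudo_arc P" and F: "involution_on P F" and x0: "x0 \<in> P" "F x0 \<noteq> x0"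
    and f: "involution_on P f" and \<epsilon>: "\<epsilon> > 0"
  shows "\<exists>g g'. homeomorphism P P g g' \<and> (\<forall>x\<in>P. dist (g (F (g' x))) (f x) < \<epsilon>)"
proof -
  note P' = pseudo_arcE[OF P] and F' = involution_onD[OF F] and f' = involution_onD[OF f]
  have \<epsilon>2: "\<epsilon> / 2 > 0"
    using \<epsilon> by simp
  obtain \<eta> where \<eta>: "\<eta> > 0" "\<forall>x\<in>P. \<forall>y\<in>P. dist x y < \<eta> \<longrightarrow> dist (f x) (f y) < \<epsilon> / 2"
    by (rule compact_uniform_modulus[OF P'(1) f'(1) \<epsilon>2])
  \<comment> \<open>Half of \<open>\<epsilon>\<close> goes to \<open>f x\<close> against
    \<open>f z\<close> for \<open>x\<close>, \<open>z\<close> in one link, the other half to two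
    points in adjacent or equal links, which are closer than \<open>2 * \<mu>\<close>.\<close>
  define \<mu> where "\<mu> = min \<eta> (\<epsilon> / 4)"
  have \<mu>: "\<mu> > 0" "\<mu> \<le> \<eta>" "2 * \<mu> \<le> \<epsilon> / 2"
    using \<eta>(1) \<epsilon> by (auto simp: \<mu>_def)
  obtain n C where C: "closed_chain P n C" "mesh_less n C \<mu>"
    using pseudo_arc_small_closed_chain[OF P \<mu>(1)] by blast
  obtain N u where N: "0 < N" "walk N n u" "\<forall>i\<le>n. \<exists>j\<le>N. u j = i"
    and u: "\<forall>j\<le>N. \<exists>z\<in>C (u j). f z \<in> C (u (N - j))"
    using involution_folding[OF P f C(1)] by blast
  obtain E where E: "closed_chain P N E" "\<forall>j\<le>N. \<forall>x\<in>E j. F x \<in> E (N - j)"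
    using symmetric_closed_chain[OF P'(1) F x0 N(1)] by blast
  obtain C' where C': "closed_chain P N C'" "\<forall>k\<le>N. C' k \<subseteq> C (u k)"
    using closed_chain_lift[OF P'(1-3) C(1) N(2,3)] by blast
  obtain g g' where g: "homeomorphism P P g g'" "\<forall>x\<in>P. \<exists>k\<le>N. x \<in> E k \<and> g x \<in> C' k"
    using closed_chain_homeomorphism[OF P E(1) C'(1)] by blast
  have "dist (g (F (g' x))) (f x) < \<epsilon>" if x: "x \<in> P" for x
  proof -
    define y where "y = g' x"
    have y: "y \<in> P" "g y = x"
      using g(1) x unfolding y_def homeomorphism_def by blast+
    obtain j where j: "j \<le> N" "y \<in> E j" "g y \<in> C' j"
      using g(2) y(1) by blast
    obtain l where l: "l \<le> N" "F y \<in> E l" "g (F y) \<in> C' l"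
      using g(2) F'(2)[OF y(1)] by blast
    have FE: "F y \<in> E (N - j)"
      using E(2) j by blast
    \<comment> \<open>Since \<open>F y\<close> may lie in two links of \<open>E\<close>, the link
      \<open>l\<close> chosen for it only neighbours or equals \<open>N - j\<close>; the walk
      \<open>u\<close> preserves this adjacency.\<close>
    have adj: "l \<le> Suc (N - j)" "N - j \<le> Suc l"
      using closed_chain_adjacent[OF E(1) l(1) _ l(2) FE] by simp_all
    obtain z where z: "z \<in> C (u j)" "f z \<in> C (u (N - j))"
      using u j(1) by blast
    have uj: "u j \<le> n" "u l \<le> n" "u (N - j) \<le> n"
      using walk_bound[OF N(2)] j(1) l(1) by simp_all
    have xC: "x \<in> C (u j)" and FC: "g (F y) \<in> C (u l)"
      using C'(2) j l y by auto
    have zP: "z \<in> P"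
      using closed_chain_subset[OF C(1) uj(1)] z(1) by blast
    have "dist x z < \<mu>"
      using C(2) uj(1) xC z(1) by (simp add: mesh_less_def)
    then have "dist (f x) (f z) < \<epsilon> / 2"
      using \<eta>(2) \<mu>(2) x zP by simp
    moreover have "dist (g (F y)) (f z) < 2 * \<mu>"
      by (rule mesh_less_adjacent[OF P'(2) C uj(2,3) _ _ FC z(2)])
        (rule walk_adjacent[OF N(2)]; use adj l(1) in simp)+
    ultimately show ?thesis
      using \<mu>(3) dist_triangle2[of "g (F y)" "f x" "f z"] unfolding y_def by linarith
  qed
  then show ?thesis
    using g(1) by blast
qed

section \<open>Uniform closeness, the compact-open topology and the group action\<close>

lemma compact_open_nbhd:
  fixes P :: "'a::metric_space set"
  assumes T: "openin (compact_open_topology (top_of_set P) (top_of_set P)) T" and f: "f \<in> T"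
  shows "\<exists>\<epsilon>>0. \<forall>h. h \<in> extensional P \<and> continuous_map (top_of_set P) (top_of_set P) h \<and>
    (\<forall>x\<in>P. dist (h x) (f x) < \<epsilon>) \<longrightarrow> h \<in> T"
proof -
  have "generate_topology_on {{f \<in> extensional P. continuous_map (top_of_set P) (top_of_set P) f \<and> f ` K \<subseteq> U} | K U.
        compactin (top_of_set P) K \<and> openin (top_of_set P) U} T"
    using T unfolding compact_open_topology_def openin_topology_generated_by_iff by simp
  then show ?thesis
    using f
  proof (induction rule: generate_topology_on.induct)
    case (Int A B)
    then obtain \<epsilon>1 \<epsilon>2 where "\<epsilon>1 > 0" "\<forall>h. h \<in> extensional P \<and> continuous_map (top_of_set P) (top_of_set P) h \<and>
        (\<forall>x\<in>P. dist (h x) (f x) < \<epsilon>1) \<longrightarrow> h \<in> A"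
      "\<epsilon>2 > 0" "\<forall>h. h \<in> extensional P \<and> continuous_map (top_of_set P) (top_of_set P) h \<and>
        (\<forall>x\<in>P. dist (h x) (f x) < \<epsilon>2) \<longrightarrow> h \<in> B"
      by auto
    then show ?case
      by (intro exI[of _ "min \<epsilon>1 \<epsilon>2"]) simp
  next
    case (UN \<K>)
    then obtain k where k: "k \<in> \<K>" "f \<in> k"
      by blast
    show ?case
      using UN.IH[OF k] k(1) by blast
  next
    case (Basis S)
    then obtain K U where S: "S = {f \<in> extensional P. continuous_map (top_of_set P) (top_of_set P) f \<and> f ` K \<subseteq> U}"
      and K: "compactin (top_of_set P) K" and U: "openin (top_of_set P) U"
      by blast
    obtain W where W: "open W" "U = P \<inter> W"
      using U by (auto simp: openin_open)
    have KP: "compact K" "K \<subseteq> P"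
      using K by (auto simp: compactin_subtopology)
    have fS: "continuous_map (top_of_set P) (top_of_set P) f" "f ` K \<subseteq> U"
      using Basis.prems S by auto
    then have "continuous_on P f"
      by simp
    then have "compact (f ` K)"
      using KP by (meson compact_continuous_image continuous_on_subset)
    \<comment> \<open>The Lebesgue number of the cover of the compact image by the single open set
      \<open>W\<close> is a uniform margin for every map near \<open>f\<close>.\<close>
    then obtain \<epsilon> where \<epsilon>: "0 < \<epsilon>" "\<And>y. y \<in> f ` K \<Longrightarrow> \<exists>G\<in>{W}. ball y \<epsilon> \<subseteq> G"
      by (rule Heine_Borel_lemma[of _ "{W}"]) (use W fS in auto)
    have "h \<in> S" if h: "h \<in> extensional P" "continuous_map (top_of_set P) (top_of_set P) h" "\<forall>x\<in>P. dist (h x) (f x) < \<epsilon>" for h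
    proof -
      have "h x \<in> U" if x: "x \<in> K" for x
      proof -
        have "x \<in> P"
          using x KP by blast
        then have "h x \<in> P" "h x \<in> ball (f x) \<epsilon>"
          using h by (auto simp: dist_commute)
        then show ?thesis
          using \<epsilon>(2)[of "f x"] x W by blast
      qed
      then show ?thesis
        using h S by blast
    qed
    then show ?case
      using \<epsilon>(1) by blast
  qed simp
qed

lemma involutions_involution_on:
  assumes "f \<in> involutions P"
  shows "involution_on P f" "f \<in> extensional P" "continuous_map (top_of_set P) (top_of_set P) f"
proof -
  have f: "f \<in> Bij P" "homeomorphic_map (top_of_set P) (top_of_set P) f" "compose P f f = (\<lambda>x\<in>P. x)"
    using assms by (auto simp: involutions_def homeo_group_def BijGroup_def)
  show "f \<in> extensional P"
    using f(1) by (simp add: Bij_def)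
  show cm: "continuous_map (top_of_set P) (top_of_set P) f"
    using f(2) by (rule homeomorphic_imp_continuous_map)
  have "f (f x) = x" if "x \<in> P" for x
    using fun_cong[OF f(3), of x] that by (simp add: compose_def)
  then show "involution_on P f"
    using cm by (auto simp: involution_on_def)
qed

lemma homeo_group_restrict:
  assumes "homeomorphism P P g g'"
  shows "restrict g P \<in> carrier (homeo_group P)"
proof -
  have "homeomorphic_maps (top_of_set P) (top_of_set P) g g'"
    using assms by (auto simp: homeomorphic_maps_def homeomorphism_def)
  then have "homeomorphic_map (top_of_set P) (top_of_set P) g"
    by (simp add: homeomorphic_maps_map)
  then have "homeomorphic_map (top_of_set P) (top_of_set P) (restrict g P)"
    by (rule homeomorphic_map_eq) simp
  moreover have "bij_betw g P P"
    using assms by (intro bij_betw_byWitness[where f' = g']) (auto simp: homeomorphism_def)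
  then have "restrict g P \<in> Bij P"
    by (simp add: Bij_def bij_betw_restrict_eq)
  ultimately show ?thesis
    by (simp add: homeo_group_def)
qed

lemma homeo_group_mult: "x \<in> carrier (homeo_group P) \<Longrightarrow> y \<in> carrier (homeo_group P) \<Longrightarrow>
    x \<otimes>\<^bsub>homeo_group P\<^esub> y = compose P x y"
  by (simp add: homeo_group_def BijGroup_def)

text \<open>The group consists of extensional functions. The group inverse of the restriction of
  \<open>g\<close> is the restriction of \<open>g'\<close>, so on \<open>P\<close> the action is
  ordinary conjugation.\<close>

lemma conjugation_action_apply:
  assumes g: "homeomorphism P P g g'" and F: "F \<in> involutions P" and x: "x \<in> P"
  shows "conjugation_action P (restrict g P) F x = g (F (g' x))"
proof -
  interpret G: group "homeo_group P"
    by (rule group_homeo_group)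
  have g': "homeomorphism P P g' g"
    using g by (simp add: homeomorphism_symD)
  note cg = homeo_group_restrict[OF g] homeo_group_restrict[OF g']
  have maps: "g' y \<in> P" "g (g' y) = y" "g' (g y) = y" if "y \<in> P" for y
    using g that unfolding homeomorphism_def by blast+
  have "restrict g' P \<otimes>\<^bsub>homeo_group P\<^esub> restrict g P = compose P (restrict g' P) (restrict g P)"
    using cg by (simp add: homeo_group_mult)
  also have "\<dots> = (\<lambda>x\<in>P. x)"
  proof
    fix y
    have "g y \<in> P" if "y \<in> P"
      using g that unfolding homeomorphism_def by blast
    then show "compose P (restrict g' P) (restrict g P) y = (\<lambda>x\<in>P. x) y"
      using maps by (simp add: compose_def)
  qed
  also have "\<dots> = \<one>\<^bsub>homeo_group P\<^esub>"
    by (simp add: homeo_group_def BijGroup_def)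
  finally have inv: "inv\<^bsub>homeo_group P\<^esub> (restrict g P) = restrict g' P"
    by (intro G.inv_equality cg)
  have Fc: "F \<in> carrier (homeo_group P)"
    using F by (simp add: involutions_def)
  have "F (g' x) \<in> P"
    using involution_onD(2)[OF involutions_involution_on(1)[OF F]] maps(1)[OF x] .
  then show ?thesis
    using F x cg Fc maps(1)[OF x] G.m_closed[OF cg(1) Fc]
    by (simp add: conjugation_action_def inv homeo_group_mult compose_def)
qed

lemma involutions_id: "(\<lambda>x\<in>P. x) \<in> involutions P"
proof -
  interpret G: group "homeo_group P"
    by (rule group_homeo_group)
  have "\<one>\<^bsub>homeo_group P\<^esub> = (\<lambda>x\<in>P. x)"
    by (simp add: homeo_group_def BijGroup_def)
  then show ?thesis
    using G.one_closed G.l_one[OF G.one_closed] by (simp add: involutions_def)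
qed

theorem theorem2p1:
  fixes P :: "'a::metric_space set"
  assumes "pseudo_arc P"
  shows "\<exists>\<O> \<in> orbits (homeo_group P) (involutions P) (conjugation_action P).
           involution_topology P closure_of \<O> = involutions P"
proof -
  interpret act: group_action "homeo_group P" "involutions P" "conjugation_action P"
    by (rule group_action_conjugation)
  \<comment> \<open>If any involution moves a point, it can serve as \<open>F\<close>. Otherwise all
    involutions agree with the identity on \<open>P\<close>, and \<open>F\<close> may be the
    identity; no existence result for nontrivial involutions is called upon.\<close>
  obtain F where F: "F \<in> involutions P" "(\<exists>x\<in>P. F x \<noteq> x) \<or> (\<forall>f\<in>involutions P. \<forall>x\<in>P. f x = x)"
    using involutions_id by blast
  define \<O> where "\<O> = orbit (homeo_group P) (conjugation_action P) F"
  have dense: "\<exists>h\<in>\<O>. \<forall>x\<in>P. dist (h x) (f x) < \<epsilon>" if f: "f \<in> involutions P" and \<epsilon>: "\<epsilon> > 0" for f and \<epsilon> :: real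
  proof -
    have "\<exists>g g'. homeomorphism P P g g' \<and> (\<forall>x\<in>P. dist (g (F (g' x))) (f x) < \<epsilon>)"
    proof (cases "\<exists>x\<in>P. F x \<noteq> x")
      case True
      then obtain x0 where "x0 \<in> P" "F x0 \<noteq> x0"
        by blast
      then show ?thesis
        using conjugates_dense[OF assms involutions_involution_on(1)[OF F(1)] _ _ involutions_involution_on(1)[OF f] \<epsilon>] by blast
    next
      case False
      then have "F x = x" "f x = x" if "x \<in> P" for x
        using F(2) f that by auto
      moreover have "homeomorphism P P id id"
        by (rule homeomorphism_ident[folded id_def])
      ultimately show ?thesis
        using \<epsilon> by (intro exI[of _ id]) simp
    qed
    then obtain g g' where g: "homeomorphism P P g g'" "\<forall>x\<in>P. dist (g (F (g' x))) (f x) < \<epsilon>"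
      by blast
    have "conjugation_action P (restrict g P) F \<in> \<O>"
      using homeo_group_restrict[OF g(1)] by (auto simp: \<O>_def orbit_def)
    moreover have "\<forall>x\<in>P. dist (conjugation_action P (restrict g P) F x) (f x) < \<epsilon>"
      using g conjugation_action_apply[OF g(1) F(1)] by simp
    ultimately show ?thesis
      by blast
  qed
  have sub: "\<O> \<subseteq> involutions P"
    using act.element_image F(1) by (auto simp: \<O>_def orbit_def)
  have "f \<in> involution_topology P closure_of \<O>" if f: "f \<in> involutions P" for f
    unfolding in_closure_of
  proof (intro conjI allI impI)
    show "f \<in> topspace (involution_topology P)"
      using f by (simp add: topspace_involution_topology)
    fix T assume T: "f \<in> T \<and> openin (involution_topology P) T"
    then obtain S where S: "openin (compact_open_topology (top_of_set P) (top_of_set P)) S" "T = S \<inter> involutions P"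
      by (auto simp: involution_topology_def openin_subtopology)
    then have fS: "f \<in> S"
      using T by blast
    obtain \<epsilon> where \<epsilon>: "\<epsilon> > 0" "\<forall>h. h \<in> extensional P \<and> continuous_map (top_of_set P) (top_of_set P) h \<and>
      (\<forall>x\<in>P. dist (h x) (f x) < \<epsilon>) \<longrightarrow> h \<in> S"
      using compact_open_nbhd[OF S(1) fS] by blast
    obtain h where h: "h \<in> \<O>" "\<forall>x\<in>P. dist (h x) (f x) < \<epsilon>"
      using dense[OF f \<epsilon>(1)] by blast
    have hI: "h \<in> involutions P"
      using h sub by blast
    have "h \<in> S"
      using \<epsilon>(2) involutions_involution_on(2,3)[OF hI] h(2) by blast
    then show "\<exists>y. y \<in> \<O> \<and> y \<in> T"
      using h(1) hI S(2) by blast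
  qed
  moreover have "involution_topology P closure_of \<O> \<subseteq> involutions P"
    using closure_of_subset_topspace topspace_involution_topology by metis
  ultimately have "involution_topology P closure_of \<O> = involutions P"
    by blast
  moreover have "\<O> \<in> orbits (homeo_group P) (involutions P) (conjugation_action P)"
    using F(1) by (auto simp: orbits_def \<O>_def)
  ultimately show ?thesis
    by blast
qed

end
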